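(* Let $n\geq 1$, let $\alpha$ be a composition of $n$ and let $E\in\mathcal E(\alpha)$ be an equivalence class of standard composition tableaux of shape $\alpha$. Then $\operatorname{End}_{H_n(0)}(\mathbf S_{\alpha,E})=\mathbb C\,\mathrm{id}$. In particular, $\mathbf S_{\alpha,E}$ is an indecomposable $H_n(0)$-module.
   Context: The 0-Hecke algebra $H_n(0)$ is the unital associative $\mathbb C$-algebra generated by $\pi_1,\dots,\pi_{n-1}$ subject to $\pi_i^2=\pi_i$, $\pi_i\pi_{i+1}\pi_i=\pi_{i+1}\pi_i\pi_{i+1}$, and $\pi_i\pi_j=\pi_j\pi_i$ for $|i-j|\ge 2$. A composition $\alpha=(\alpha_1,\dots,\alpha_l)$ of $n$ is a sequence of positive integers with sum $n$. Its diagram is $\{(i,j)\in\mathbb N^2: i\le l,\ j\le\alpha_i\}$, drawn in matrix coordinates (row $1$ on top, row $i$ has $\alpha_i$ cells). A standard composition tableau (SCT) of shape $\alpha$ is a bijection $T$ from the diagram of $\alpha$ to $[n]=\{1,\dots,n\}$ such that: (1) entries decrease along each row from left to right; (2) entries of the first column increase from top to bottom; (3) (triple rule) if $(j,k)$ and $(i,k-1)$ are cells of $\alpha$ with $j>i$ and $T(j,k)<T(i,k-1)$, then $(i,k)$ is a cell of $\alpha$ and $T(j,k)<T(i,k)$. Let $\mathrm{SCT}(\alpha)$ be the set of these. For an entry $k$ of $T$ let $c_T(k)$ be the column of the cell $T^{-1}(k)$. A cell $(i,j)$ attacks a cell $(i',j')$ if either $j=j'$ and $i\ne i'$, or $j=j'-1$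 and $i<i'$; entry $a$ attacks entry $b$ in $T$ if $T^{-1}(a)$ attacks $T^{-1}(b)$. Define $D(T)=\{i\in[n-1]: c_T(i)\le c_T(i+1)\}$, $AD(T)=\{i\in D(T): i \text{ attacks } i+1 \text{ in } T\}$, $nAD(T)=D(T)\setminus AD(T)$. The space $\mathbf S_\alpha=\operatorname{span}_{\mathbb C}\mathrm{SCT}(\alpha)$ is an $H_n(0)$-module via $\pi_iT=T$ if $i\notin D(T)$, $\pi_iT=0$ if $i\in AD(T)$, and $\pi_iT=s_iT$ if $i\in nAD(T)$, where $s_iT$ is obtained from $T$ by interchanging the entries $i$ and $i+1$ (it is again an SCT). Two tableaux $T_1,T_2\in\mathrm{SCT}(\alpha)$ are equivalent, $T_1\sim T_2$, if in each column the relative order of the entries of $T_1$ coincides with that of $T_2$. $\mathcal E(\alpha)$ denotes the set of equivalence classes, and for $E\in\mathcal E(\alpha)$, $\mathbf S_{\alpha,E}=\operatorname{span}_{\mathbb C}E$, which is an $H_n(0)$-submodule of $\mathbf S_\alpha$. *)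

theory Defs
  imports
    Complex_Main
    "HOL-Library.Poly_Mapping"
    "HOL-Library.FuncSet"
    "HOL-Combinatorics.Transposition"
    "HOL-Algebra.QuotRing"
    "HOL-Algebra.Module"
begin

section \<open>Formal complex linear combinations\<close>

definition cscale :: "complex \<Rightarrow> ('a \<Rightarrow>\<^sub>0 complex) \<Rightarrow> ('a \<Rightarrow>\<^sub>0 complex)" where
  "cscale c v = Poly_Mapping.map (\<lambda>z. c * z) v"

definition lin_ext :: "('a \<Rightarrow> ('b \<Rightarrow>\<^sub>0 complex)) \<Rightarrow> ('a \<Rightarrow>\<^sub>0 complex) \<Rightarrow> ('b \<Rightarrow>\<^sub>0 complex)" where
  "lin_ext f v = (\<Sum>b\<in>Poly_Mapping.keys v. cscale (Poly_Mapping.lookup v b) (f b))"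


section \<open>The 0-Hecke algebra\<close>

text \<open>Words form the free monoid, written additively because \<^typ>\<open>'a \<Rightarrow>\<^sub>0 'b\<close> is
  the monoid algebra of an additive monoid. Hence \<open>word \<Rightarrow>\<^sub>0 complex\<close> is the free associative
  unital algebra on generators indexed by the natural numbers.\<close>

datatype word = Word (letters: "nat list")

instantiation word :: monoid_add
begin

definition zero_word :: word where "0 = Word []"

definition plus_word :: "word \<Rightarrow> word \<Rightarrow> word" where
  "u + v = Word (letters u @ letters v)"

instance
  by standard (simp_all add: zero_word_def plus_word_def)

end

definition free_alg :: "nat \<Rightarrow> (word \<Rightarrow>\<^sub>0 complex) ring" where
  "free_alg n =
    \<lparr>carrier = {p. \<forall>w\<in>Poly_Mapping.keys p. set (letters w) \<subseteq> {1..<n}},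
     mult = (*), one = 1, zero = 0, add = (+)\<rparr>"

definition gen :: "nat \<Rightarrow> (word \<Rightarrow>\<^sub>0 complex)" where
  "gen i = Poly_Mapping.single (Word [i]) 1"

definition hecke_rels :: "nat \<Rightarrow> (word \<Rightarrow>\<^sub>0 complex) set" where
  "hecke_rels n =
     {gen i * gen i - gen i | i. i \<in> {1..<n}} \<union>
     {gen i * gen (i + 1) * gen i - gen (i + 1) * gen i * gen (i + 1)
       | i. i \<in> {1..<n} \<and> i + 1 \<in> {1..<n}} \<union>
     {gen i * gen j - gen j * gen i
       | i j. i \<in> {1..<n} \<and> j \<in> {1..<n} \<and> \<bar>int i - int j\<bar> \<ge> 2}"

text \<open>\<^const>\<open>genideal\<close> is the two-sided ideal generated by a set; it is closed under complex
  scalars since these lie in \<^term>\<open>carrier (free_alg n)\<close>.\<close>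

definition hecke0 :: "nat \<Rightarrow> (word \<Rightarrow>\<^sub>0 complex) set ring" where
  "hecke0 n = free_alg n Quot (Idl\<^bsub>free_alg n\<^esub> (hecke_rels n))"


section \<open>Left modules over a not necessarily commutative ring\<close>

text \<open>The locale \<^locale>\<open>module\<close> of HOL-Algebra requires a commutative ring; the axioms
  below are the same without commutativity. As there, the fields \<^const>\<open>mult\<close> and
  \<^const>\<open>one\<close> of the module record are irrelevant.\<close>

locale left_module = R?: ring R + M?: abelian_group M
  for R :: "('a, 'r) ring_scheme" (structure) and M :: "('a, 'b, 'm) module_scheme" (structure) +
  assumes smult_closed:
      "\<lbrakk>a \<in> carrier R; x \<in> carrier M\<rbrakk> \<Longrightarrow> a \<odot>\<^bsub>M\<^esub> x \<in> carrier M"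
    and smult_l_distr:
      "\<lbrakk>a \<in> carrier R; b \<in> carrier R; x \<in> carrier M\<rbrakk> \<Longrightarrow>
       (a \<oplus>\<^bsub>R\<^esub> b) \<odot>\<^bsub>M\<^esub> x = a \<odot>\<^bsub>M\<^esub> x \<oplus>\<^bsub>M\<^esub> b \<odot>\<^bsub>M\<^esub> x"
    and smult_r_distr:
      "\<lbrakk>a \<in> carrier R; x \<in> carrier M; y \<in> carrier M\<rbrakk> \<Longrightarrow>
       a \<odot>\<^bsub>M\<^esub> (x \<oplus>\<^bsub>M\<^esub> y) = a \<odot>\<^bsub>M\<^esub> x \<oplus>\<^bsub>M\<^esub> a \<odot>\<^bsub>M\<^esub> y"
    and smult_assoc1:
      "\<lbrakk>a \<in> carrier R; b \<in> carrier R; x \<in> carrier M\<rbrakk> \<Longrightarrow>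
       (a \<otimes>\<^bsub>R\<^esub> b) \<odot>\<^bsub>M\<^esub> x = a \<odot>\<^bsub>M\<^esub> (b \<odot>\<^bsub>M\<^esub> x)"
    and smult_one:
      "x \<in> carrier M \<Longrightarrow> \<one>\<^bsub>R\<^esub> \<odot>\<^bsub>M\<^esub> x = x"

text \<open>Endomorphisms are extensional functions, so that they are determined by their values
  on the carrier.\<close>

definition module_End ::
  "('a, 'r) ring_scheme \<Rightarrow> ('a, 'b, 'm) module_scheme \<Rightarrow> ('b \<Rightarrow> 'b) set" where
  "module_End R M =
    {f \<in> carrier M \<rightarrow>\<^sub>E carrier M.
       (\<forall>x\<in>carrier M. \<forall>y\<in>carrier M. f (x \<oplus>\<^bsub>M\<^esub> y) = f x \<oplus>\<^bsub>M\<^esub> f y) \<and>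
       (\<forall>a\<in>carrier R. \<forall>x\<in>carrier M. f (a \<odot>\<^bsub>M\<^esub> x) = a \<odot>\<^bsub>M\<^esub> f x)}"

definition indecomposable_module ::
  "('a, 'r) ring_scheme \<Rightarrow> ('a, 'b, 'm) module_scheme \<Rightarrow> bool" where
  "indecomposable_module R M \<longleftrightarrow>
     left_module R M \<and> carrier M \<noteq> {\<zero>\<^bsub>M\<^esub>} \<and>
     (\<forall>U W. submodule U R M \<and> submodule W R M \<and>
        U \<inter> W = {\<zero>\<^bsub>M\<^esub>} \<and> U <+>\<^bsub>M\<^esub> W = carrier M \<longrightarrow>
        U = {\<zero>\<^bsub>M\<^esub>} \<or> W = {\<zero>\<^bsub>M\<^esub>})"


section \<open>Standard composition tableaux\<close>

definition compositions :: "nat \<Rightarrow> nat list set" where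
  "compositions n = {\<alpha>. (\<forall>a\<in>set \<alpha>. 1 \<le> a) \<and> sum_list \<alpha> = n}"

text \<open>Rows and columns are numbered from 1, list positions from 0.\<close>

definition diagram :: "nat list \<Rightarrow> (nat \<times> nat) set" where
  "diagram \<alpha> = {(i, j). 1 \<le> i \<and> i \<le> length \<alpha> \<and> 1 \<le> j \<and> j \<le> \<alpha> ! (i - 1)}"

type_synonym tableau = "nat \<times> nat \<Rightarrow> nat"

definition SCT :: "nat list \<Rightarrow> tableau set" where
  "SCT \<alpha> = {T \<in> diagram \<alpha> \<rightarrow>\<^sub>E {1..sum_list \<alpha>}.
     bij_betw T (diagram \<alpha>) {1..sum_list \<alpha>} \<and>
     (\<forall>i j k. (i, j) \<in> diagram \<alpha> \<and> (i, k) \<in> diagram \<alpha> \<and> j < k \<longrightarrow> T (i, k) < T (i, j)) \<and>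
     (\<forall>i j. (i, 1) \<in> diagram \<alpha> \<and> (j, 1) \<in> diagram \<alpha> \<and> i < j \<longrightarrow> T (i, 1) < T (j, 1)) \<and>
     (\<forall>i j k. (j, k) \<in> diagram \<alpha> \<and> (i, k - 1) \<in> diagram \<alpha> \<and> i < j \<and> T (j, k) < T (i, k - 1) \<longrightarrow>
        (i, k) \<in> diagram \<alpha> \<and> T (j, k) < T (i, k))}"

definition cell_of :: "nat list \<Rightarrow> tableau \<Rightarrow> nat \<Rightarrow> nat \<times> nat" where
  "cell_of \<alpha> T k = the_inv_into (diagram \<alpha>) T k"

definition col_of :: "nat list \<Rightarrow> tableau \<Rightarrow> nat \<Rightarrow> nat" where
  "col_of \<alpha> T k = snd (cell_of \<alpha> T k)"

fun attacks :: "nat \<times> nat \<Rightarrow> nat \<times> nat \<Rightarrow> bool" where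
  "attacks (i, j) (i', j') \<longleftrightarrow> (j = j' \<and> i \<noteq> i') \<or> (j + 1 = j' \<and> i < i')"

definition Des :: "nat list \<Rightarrow> tableau \<Rightarrow> nat set" where
  "Des \<alpha> T = {i \<in> {1..<sum_list \<alpha>}. col_of \<alpha> T i \<le> col_of \<alpha> T (i + 1)}"

definition ADes :: "nat list \<Rightarrow> tableau \<Rightarrow> nat set" where
  "ADes \<alpha> T = {i \<in> Des \<alpha> T. attacks (cell_of \<alpha> T i) (cell_of \<alpha> T (i + 1))}"

definition nADes :: "nat list \<Rightarrow> tableau \<Rightarrow> nat set" where
  "nADes \<alpha> T = Des \<alpha> T - ADes \<alpha> T"

definition swap_entries :: "nat list \<Rightarrow> nat \<Rightarrow> tableau \<Rightarrow> tableau" where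
  "swap_entries \<alpha> i T = (\<lambda>c\<in>diagram \<alpha>. transpose i (i + 1) (T c))"

definition sct_equiv :: "nat list \<Rightarrow> (tableau \<times> tableau) set" where
  "sct_equiv \<alpha> = {(T\<^sub>1, T\<^sub>2). T\<^sub>1 \<in> SCT \<alpha> \<and> T\<^sub>2 \<in> SCT \<alpha> \<and>
     (\<forall>i j k. (i, k) \<in> diagram \<alpha> \<and> (j, k) \<in> diagram \<alpha> \<longrightarrow>
        (T\<^sub>1 (i, k) < T\<^sub>1 (j, k) \<longleftrightarrow> T\<^sub>2 (i, k) < T\<^sub>2 (j, k)))}"

definition sct_classes :: "nat list \<Rightarrow> tableau set set" where
  "sct_classes \<alpha> = SCT \<alpha> // sct_equiv \<alpha>"


section \<open>The modules spanned by standard composition tableaux\<close>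

definition pi_tab :: "nat list \<Rightarrow> nat \<Rightarrow> tableau \<Rightarrow> (tableau \<Rightarrow>\<^sub>0 complex)" where
  "pi_tab \<alpha> i T =
     (if i \<in> ADes \<alpha> T then 0
      else if i \<in> nADes \<alpha> T then Poly_Mapping.single (swap_entries \<alpha> i T) 1
      else Poly_Mapping.single T 1)"

definition pi_op :: "nat list \<Rightarrow> nat \<Rightarrow> (tableau \<Rightarrow>\<^sub>0 complex) \<Rightarrow> (tableau \<Rightarrow>\<^sub>0 complex)" where
  "pi_op \<alpha> i = lin_ext (pi_tab \<alpha> i)"

definition free_act ::
  "nat list \<Rightarrow> (word \<Rightarrow>\<^sub>0 complex) \<Rightarrow> (tableau \<Rightarrow>\<^sub>0 complex) \<Rightarrow> (tableau \<Rightarrow>\<^sub>0 complex)" where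
  "free_act \<alpha> p v = lin_ext (\<lambda>w. foldr (pi_op \<alpha>) (letters w) v) p"

text \<open>An element of \<^const>\<open>hecke0\<close> is a coset \<open>X\<close> of elements of the free algebra; it acts as
  any of its representatives does. On \<open>span SCT(\<alpha>)\<close> this does not depend on the representative,
  because the operators \<^term>\<open>pi_op \<alpha> i\<close> satisfy the defining relations there.\<close>

definition S_module ::
  "nat list \<Rightarrow> tableau set \<Rightarrow> ((word \<Rightarrow>\<^sub>0 complex) set, tableau \<Rightarrow>\<^sub>0 complex) module" where
  "S_module \<alpha> E =
    \<lparr>carrier = {v. Poly_Mapping.keys v \<subseteq> E},
     mult = undefined, one = undefined, zero = 0, add = (+),
     smult = (\<lambda>X v. the_elem ((\<lambda>p. free_act \<alpha> p v) ` X))\<rparr>"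

end

theory Submission
  imports Defs
begin

text \<open>Every equivalence class contains a unique source tableau \<open>T\<^sub>0\<close>, in which each non-descent \<open>i\<close>
  is the right neighbour of \<open>i + 1\<close>, and \<open>T\<^sub>0\<close> generates the module. Let \<open>v\<close> be the image of \<open>T\<^sub>0\<close>
  under an endomorphism. The equations \<open>\<pi>\<^sub>i v = v\<close> for the non-descents \<open>i\<close> of \<open>T\<^sub>0\<close> force every \<open>T\<close>
  in the support of \<open>v\<close> to have \<open>D(T) \<subseteq> D(T\<^sub>0)\<close>. For such a \<open>T \<noteq> T\<^sub>0\<close> there are \<open>k < j\<close> such that
  \<open>\<pi>\<^bsub>j-1\<^esub> \<dots> \<pi>\<^bsub>k\<^esub>\<close> annihilates \<open>T\<^sub>0\<close>, whereas in \<open>T\<close> every factor acts by a proper interchange.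
  If \<open>T\<close> has the maximal number of inversions in the support, its coefficient survives in the image
  \<open>0\<close> of \<open>v\<close> under this product, a contradiction. Hence \<open>v\<close> is a multiple of \<open>T\<^sub>0\<close>.\<close>

text \<open>The support condition comes from the image of a single operator: \<open>pi_i\<close>
  only produces tableaux in which \<open>i\<close> is a non-descent. The word is found at the last
  entry \<open>k\<close> that \<open>T\<close> and \<open>T0\<close> place differently. The class is
  built from its source by interchanging non-attacking cells, the smaller entry being in the earlier
  column; so two cells whose order differs between \<open>T0\<close> and \<open>T\<close> were
  interchanged on the way. Hence the cell of \<open>k\<close> in \<open>T\<close> lies strictly left
  of its cell in \<open>T0\<close> and does not attack it. The word raises \<open>k\<close> until it
  meets the first later entry \<open>j\<close> that it attacks in \<open>T0\<close>. That such a
  \<open>j\<close> exists is where the inclusion of descent sets enters; that \<open>k\<close>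
  attacks none of these entries from its cell in \<open>T\<close> is where the triple rule enters.
  Inversions control cancellation: a proper interchange adds exactly one inversion and is injective,
  so no other tableau with at most as many inversions contributes to the coefficient that is
  followed. Indecomposability then follows because the projection onto a direct summand must be a
  scalar.\<close>

subsection \<open>Linear maps on formal linear combinations\<close>

lemma lookup_cscale [simp]: "Poly_Mapping.lookup (cscale c v) x = c * Poly_Mapping.lookup v x"
  by (simp add: cscale_def Poly_Mapping.map.rep_eq when_def)

lemma keys_cscale: "Poly_Mapping.keys (cscale c v) \<subseteq> Poly_Mapping.keys v"
  by (auto simp: in_keys_iff)

lemma cscale_simps [simp]:
  "cscale c 0 = 0" "cscale 0 v = 0" "cscale 1 v = v"
  "cscale c (cscale d v) = cscale (c * d) v" "cscale (- 1) v = - v"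
  by (auto intro!: poly_mapping_eqI)

lemma cscale_add_right: "cscale c (u + v) = cscale c u + cscale c v"
  by (rule poly_mapping_eqI) (simp add: lookup_add algebra_simps)

lemma cscale_add_left: "cscale (c + d) v = cscale c v + cscale d v"
  by (rule poly_mapping_eqI) (simp add: lookup_add algebra_simps)

text \<open>Scalars are the multiples of the neutral element of the monoid, so compatibility of
  products with scalars becomes an instance of associativity.\<close>

lemma cscale_conv_mult:
  fixes v :: "'a :: monoid_add \<Rightarrow>\<^sub>0 complex"
  shows "cscale c v = Poly_Mapping.single 0 c * v"
  by (simp add: cscale_def mult_map_scale_conv_mult)

definition clin :: "(('a \<Rightarrow>\<^sub>0 complex) \<Rightarrow> ('b \<Rightarrow>\<^sub>0 complex)) \<Rightarrow> bool" where
  "clin g \<longleftrightarrow> (\<forall>u v. g (u + v) = g u + g v) \<and> (\<forall>c v. g (cscale c v) = cscale c (g v))"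

lemma clinI:
  "\<lbrakk>\<And>u v. g (u + v) = g u + g v; \<And>c v. g (cscale c v) = cscale c (g v)\<rbrakk> \<Longrightarrow> clin g"
  by (simp add: clin_def)

lemma
  assumes "clin g"
  shows clin_add: "g (u + v) = g u + g v"
    and clin_scale: "g (cscale c v) = cscale c (g v)"
    and clin_zero: "g 0 = 0"
    and clin_uminus: "g (- v) = - g v"
    and clin_diff: "g (u - v) = g u - g v"
proof -
  show add: "g (u + v) = g u + g v" for u v
    using assms by (simp add: clin_def)
  show scale: "g (cscale c v) = cscale c (g v)" for c v
    using assms by (simp add: clin_def)
  show "g 0 = 0"
    using scale[of 0 0] by simp
  show uminus: "g (- v) = - g v" for v
    using scale[of "- 1" v] by simp
  show "g (u - v) = g u - g v"
    using add[of u "- v"] uminus[of v] by simp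
qed

lemma clin_sum: "clin g \<Longrightarrow> g (\<Sum>x\<in>A. h x) = (\<Sum>x\<in>A. g (h x))"
  by (induction A rule: infinite_finite_induct) (simp_all add: clin_add clin_zero)

lemma lookup_lin_ext:
  "Poly_Mapping.lookup (lin_ext f v) x =
     (\<Sum>b\<in>Poly_Mapping.keys v. Poly_Mapping.lookup v b * Poly_Mapping.lookup (f b) x)"
  by (simp add: lin_ext_def lookup_sum)

lemma lin_ext_superset:
  assumes "finite S" "Poly_Mapping.keys v \<subseteq> S"
  shows "lin_ext f v = (\<Sum>b\<in>S. cscale (Poly_Mapping.lookup v b) (f b))"
  unfolding lin_ext_def using assms
  by (intro sum.mono_neutral_left) (auto simp: in_keys_iff)

lemma clin_lin_ext: "clin (lin_ext f)"
proof (rule clinI)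
  fix u v :: "'a \<Rightarrow>\<^sub>0 complex" and c :: complex
  \<comment> \<open>Cancellation can make the support of \<open>u + v\<close> smaller, so all three
    sums are taken over one common finite set.\<close>
  let ?S = "Poly_Mapping.keys u \<union> Poly_Mapping.keys v"
  have "lin_ext f (u + v) = (\<Sum>b\<in>?S. cscale (Poly_Mapping.lookup (u + v) b) (f b))"
    using keys_add[of u v] by (intro lin_ext_superset) auto
  also have "\<dots> = (\<Sum>b\<in>?S. cscale (Poly_Mapping.lookup u b) (f b)) +
                  (\<Sum>b\<in>?S. cscale (Poly_Mapping.lookup v b) (f b))"
    by (simp add: lookup_add cscale_add_left sum.distrib)
  also have "\<dots> = lin_ext f u + lin_ext f v"
    by (simp add: lin_ext_superset[of ?S])
  finally show "lin_ext f (u + v) = lin_ext f u + lin_ext f v" .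
  have "lin_ext f (cscale c v) =
      (\<Sum>b\<in>Poly_Mapping.keys v. cscale (Poly_Mapping.lookup (cscale c v) b) (f b))"
    using keys_cscale[of c v] by (intro lin_ext_superset) auto
  also have "\<dots> = cscale c (lin_ext f v)"
    by (rule poly_mapping_eqI) (simp add: lookup_sum lookup_lin_ext sum_distrib_left mult.assoc)
  finally show "lin_ext f (cscale c v) = cscale c (lin_ext f v)" .
qed

lemma lin_ext_single [simp]: "lin_ext f (Poly_Mapping.single b c) = cscale c (f b)"
  by (simp add: lin_ext_def)

lemma lin_ext_basis: "lin_ext (\<lambda>b. Poly_Mapping.single b 1) v = v"
  by (rule poly_mapping_eqI)
    (auto simp: lookup_lin_ext lookup_single when_def in_keys_iff if_distrib[of "\<lambda>z. _ * z"]
      cong: if_cong)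

lemma clin_conv_lin_ext:
  assumes "clin g"
  shows "g v = lin_ext (\<lambda>b. g (Poly_Mapping.single b 1)) v"
proof -
  have "g v = g (lin_ext (\<lambda>b. Poly_Mapping.single b 1) v)"
    by (simp add: lin_ext_basis)
  also have "\<dots> = lin_ext (\<lambda>b. g (Poly_Mapping.single b 1)) v"
    by (simp only: lin_ext_def clin_sum[OF assms] clin_scale[OF assms])
  finally show ?thesis .
qed

lemma lin_ext_cong:
  "(\<And>b. b \<in> Poly_Mapping.keys v \<Longrightarrow> f b = g b) \<Longrightarrow> lin_ext f v = lin_ext g v"
  by (simp add: lin_ext_def)

text \<open>Agreement is asked for only on the support of \<open>v\<close>: the Hecke relations are
  known on tableaux in \<open>SCT \<alpha>\<close>, not on arbitrary functions of type
  \<open>tableau\<close>.\<close>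

lemma clin_eqI:
  assumes "clin g" "clin h"
    and "\<And>b. b \<in> Poly_Mapping.keys v \<Longrightarrow>
           g (Poly_Mapping.single b 1) = h (Poly_Mapping.single b 1)"
  shows "g v = h v"
  unfolding clin_conv_lin_ext[OF assms(1), of v] clin_conv_lin_ext[OF assms(2), of v]
  using assms(3) by (rule lin_ext_cong)

lemma keys_lin_ext:
  "Poly_Mapping.keys (lin_ext f v) \<subseteq> (\<Union>b\<in>Poly_Mapping.keys v. Poly_Mapping.keys (f b))"
proof
  fix x assume "x \<in> Poly_Mapping.keys (lin_ext f v)"
  then have "(\<Sum>b\<in>Poly_Mapping.keys v. Poly_Mapping.lookup v b * Poly_Mapping.lookup (f b) x) \<noteq> 0"
    by (simp add: in_keys_iff lookup_lin_ext)
  then obtain b where "b \<in> Poly_Mapping.keys v" "Poly_Mapping.lookup (f b) x \<noteq> 0"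
    by (metis (no_types, lifting) mult_eq_0_iff sum.neutral)
  then show "x \<in> (\<Union>b\<in>Poly_Mapping.keys v. Poly_Mapping.keys (f b))"
    by (auto simp: in_keys_iff)
qed

lemma clin_comp: "clin g \<Longrightarrow> clin h \<Longrightarrow> clin (\<lambda>v. g (h v))"
  by (simp add: clin_def)


subsection \<open>Entries and cells of a standard composition tableau\<close>

lemma SCT_D:
  assumes "T \<in> SCT \<alpha>"
  shows SCT_ext: "T \<in> diagram \<alpha> \<rightarrow>\<^sub>E {1..sum_list \<alpha>}"
    and SCT_bij: "bij_betw T (diagram \<alpha>) {1..sum_list \<alpha>}"
    and SCT_row: "\<lbrakk>(i, j) \<in> diagram \<alpha>; (i, k) \<in> diagram \<alpha>; j < k\<rbrakk> \<Longrightarrow> T (i, k) < T (i, j)"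
    and SCT_triple: "\<lbrakk>(j, k) \<in> diagram \<alpha>; (i, k - 1) \<in> diagram \<alpha>; i < j; T (j, k) < T (i, k - 1)\<rbrakk>
           \<Longrightarrow> (i, k) \<in> diagram \<alpha> \<and> T (j, k) < T (i, k)"
  using assms unfolding SCT_def mem_Collect_eq by blast+

lemma diagram_left: "\<lbrakk>(r, q) \<in> diagram \<alpha>; 1 \<le> p; p \<le> q\<rbrakk> \<Longrightarrow> (r, p) \<in> diagram \<alpha>"
  by (auto simp: diagram_def)

lemma diagram_pos: "(r, q) \<in> diagram \<alpha> \<Longrightarrow> 1 \<le> q"
  by (auto simp: diagram_def)

lemma entry_in_range:
  "T \<in> SCT \<alpha> \<Longrightarrow> x \<in> diagram \<alpha> \<Longrightarrow> T x \<in> {1..sum_list \<alpha>}"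
  using SCT_ext by blast

lemma finite_diagram: "T \<in> SCT \<alpha> \<Longrightarrow> finite (diagram \<alpha>)"
  using bij_betw_finite[OF SCT_bij] by auto

lemma cell_of_in_diagram:
  "\<lbrakk>T \<in> SCT \<alpha>; k \<in> {1..sum_list \<alpha>}\<rbrakk> \<Longrightarrow> cell_of \<alpha> T k \<in> diagram \<alpha>"
  unfolding cell_of_def using SCT_bij
  by (metis bij_betw_def order_refl the_inv_into_into)

lemma entry_cell_of [simp]:
  "\<lbrakk>T \<in> SCT \<alpha>; k \<in> {1..sum_list \<alpha>}\<rbrakk> \<Longrightarrow> T (cell_of \<alpha> T k) = k"
  unfolding cell_of_def using SCT_bij by (metis bij_betw_def f_the_inv_into_f)

lemma cell_of_entry [simp]:
  "\<lbrakk>T \<in> SCT \<alpha>; x \<in> diagram \<alpha>\<rbrakk> \<Longrightarrow> cell_of \<alpha> T (T x) = x"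
  unfolding cell_of_def using SCT_bij by (metis bij_betw_def the_inv_into_f_f)

lemma cell_of_inj:
  "\<lbrakk>T \<in> SCT \<alpha>; k \<in> {1..sum_list \<alpha>}; l \<in> {1..sum_list \<alpha>}\<rbrakk>
     \<Longrightarrow> cell_of \<alpha> T k = cell_of \<alpha> T l \<longleftrightarrow> k = l"
  by (metis entry_cell_of)

lemma SCT_eqI:
  assumes T: "T \<in> SCT \<alpha>" and U: "U \<in> SCT \<alpha>"
    and cells: "\<And>k. k \<in> {1..sum_list \<alpha>} \<Longrightarrow> cell_of \<alpha> T k = cell_of \<alpha> U k"
  shows "T = U"
proof (rule PiE_ext[OF SCT_ext[OF T] SCT_ext[OF U]])
  fix x assume x: "x \<in> diagram \<alpha>"
  then show "T x = U x"
    using cells[OF entry_in_range[OF T x]] T U entry_in_range[OF T x] by (metis cell_of_entry entry_cell_of)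
qed

lemma equiv_sct_equiv: "equiv (SCT \<alpha>) (sct_equiv \<alpha>)"
proof (rule equivI)
  show "sct_equiv \<alpha> \<subseteq> SCT \<alpha> \<times> SCT \<alpha>"
    by (auto simp: sct_equiv_def)
  show "refl_on (SCT \<alpha>) (sct_equiv \<alpha>)"
    by (auto simp: refl_on_def sct_equiv_def)
  show "sym (sct_equiv \<alpha>)"
    unfolding sym_def sct_equiv_def by auto
  show "trans (sct_equiv \<alpha>)"
    unfolding trans_def sct_equiv_def by auto
qed

lemma sct_equivD:
  "\<lbrakk>(T, U) \<in> sct_equiv \<alpha>; (i, k) \<in> diagram \<alpha>; (j, k) \<in> diagram \<alpha>\<rbrakk>
     \<Longrightarrow> T (i, k) < T (j, k) \<longleftrightarrow> U (i, k) < U (j, k)"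
  by (auto simp: sct_equiv_def)


subsection \<open>Interchanging consecutive entries\<close>

text \<open>Every comparison of entries made by the SCT axioms or by \<open>sct_equiv\<close> is
  between cells of one row, of one column, or between a cell and one that it attacks. Swappable
  cells are exactly outside these comparisons. The condition is symmetric, so it serves for an
  interchange and for its undoing.\<close>

definition swappable :: "nat \<times> nat \<Rightarrow> nat \<times> nat \<Rightarrow> bool" where
  "swappable x y \<longleftrightarrow> fst x \<noteq> fst y \<and> snd x \<noteq> snd y \<and> \<not> attacks x y \<and> \<not> attacks y x"

lemma transpose_less_iff:
  "{a, b} \<noteq> {i, Suc i} \<Longrightarrow> transpose i (Suc i) a < transpose i (Suc i) b \<longleftrightarrow> a < b"
  by (auto simp: transpose_def)

lemma swap_entries_less_iff:
  assumes T: "T \<in> SCT \<alpha>" and i: "i \<in> {1..<sum_list \<alpha>}"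
    and p: "p \<in> diagram \<alpha>" and q: "q \<in> diagram \<alpha>"
    and ne: "{p, q} \<noteq> {cell_of \<alpha> T i, cell_of \<alpha> T (Suc i)}"
  shows "swap_entries \<alpha> i T p < swap_entries \<alpha> i T q \<longleftrightarrow> T p < T q"
proof -
  have "{T p, T q} \<noteq> {i, Suc i}"
  proof
    assume "{T p, T q} = {i, Suc i}"
    then have "cell_of \<alpha> T ` {T p, T q} = cell_of \<alpha> T ` {i, Suc i}"
      by simp
    then show False
      using ne T p q by simp
  qed
  then show ?thesis
    using transpose_less_iff p q by (simp add: swap_entries_def)
qed

lemma swap_entries_SCT:
  assumes T: "T \<in> SCT \<alpha>" and i: "i \<in> {1..<sum_list \<alpha>}"
    and sw: "swappable (cell_of \<alpha> T i) (cell_of \<alpha> T (Suc i))"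
  shows "swap_entries \<alpha> i T \<in> SCT \<alpha>" "(T, swap_entries \<alpha> i T) \<in> sct_equiv \<alpha>"
proof -
  let ?U = "swap_entries \<alpha> i T"
  have less: "?U p < ?U q \<longleftrightarrow> T p < T q"
    if "p \<in> diagram \<alpha>" "q \<in> diagram \<alpha>" "\<not> swappable p q" for p q
  proof (rule swap_entries_less_iff[OF T i that(1,2)])
    show "{p, q} \<noteq> {cell_of \<alpha> T i, cell_of \<alpha> T (Suc i)}"
      using sw that(3) by (auto simp: doubleton_eq_iff swappable_def)
  qed
  have bij: "bij_betw ?U (diagram \<alpha>) {1..sum_list \<alpha>}"
  proof -
    have "bij_betw (transpose i (Suc i)) {1..sum_list \<alpha>} {1..sum_list \<alpha>}"
      using i by (intro bij_betwI[where g = "transpose i (Suc i)"]) (auto simp: transpose_def)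
    then have "bij_betw (transpose i (Suc i) \<circ> T) (diagram \<alpha>) {1..sum_list \<alpha>}"
      using SCT_bij[OF T] by (rule bij_betw_trans[rotated])
    then show ?thesis
      by (rule bij_betw_cong[THEN iffD1, rotated]) (simp add: swap_entries_def)
  qed
  have ext: "?U \<in> diagram \<alpha> \<rightarrow>\<^sub>E {1..sum_list \<alpha>}"
    using bij_betwE[OF bij] by (auto simp: swap_entries_def)
  have row: "?U (r, k) < ?U (r, j)"
    if "(r, j) \<in> diagram \<alpha>" "(r, k) \<in> diagram \<alpha>" "j < k" for r j k
    using SCT_row[OF T that] less[of "(r, k)" "(r, j)"] that by (auto simp: swappable_def)
  have col: "?U (r, k) < ?U (s, k) \<longleftrightarrow> T (r, k) < T (s, k)"
    if "(r, k) \<in> diagram \<alpha>" "(s, k) \<in> diagram \<alpha>" for r s k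
    using less[of "(r, k)" "(s, k)"] that by (auto simp: swappable_def)
  have triple: "(r, k) \<in> diagram \<alpha> \<and> ?U (s, k) < ?U (r, k)"
    if "(s, k) \<in> diagram \<alpha>" "(r, k - 1) \<in> diagram \<alpha>" "r < s" "?U (s, k) < ?U (r, k - 1)" for r s k
  proof -
    \<comment> \<open>Subtraction is truncated: \<open>attacks\<close> compares
      \<open>k - 1 + 1\<close> with \<open>k\<close>, which are equal only for positive
      \<open>k\<close>.\<close>
    have "k - 1 \<ge> 1"
      using diagram_pos[OF that(2)] .
    then have "attacks (r, k - 1) (s, k)"
      using that(3) by simp
    then have "T (s, k) < T (r, k - 1)"
      using less[OF that(1,2)] that(4) by (simp add: swappable_def)
    then show ?thesis
      using SCT_triple[OF T that(1-3)] col that(1) by blast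
  qed
  have col1: "T (r, 1) < T (s, 1)" if "(r, 1) \<in> diagram \<alpha>" "(s, 1) \<in> diagram \<alpha>" "r < s" for r s
    using T that unfolding SCT_def mem_Collect_eq by blast
  show "?U \<in> SCT \<alpha>"
    unfolding SCT_def mem_Collect_eq
    using bij ext row col1 col triple by (intro conjI allI impI) blast+
  then show "(T, ?U) \<in> sct_equiv \<alpha>"
    using T col by (auto simp: sct_equiv_def)
qed

lemma cell_of_swap_entries:
  assumes T: "T \<in> SCT \<alpha>" and U: "swap_entries \<alpha> i T \<in> SCT \<alpha>"
    and i: "i \<in> {1..<sum_list \<alpha>}" and k: "k \<in> {1..sum_list \<alpha>}"
  shows "cell_of \<alpha> (swap_entries \<alpha> i T) k = cell_of \<alpha> T (transpose i (Suc i) k)"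
proof -
  let ?x = "cell_of \<alpha> T (transpose i (Suc i) k)"
  have t: "transpose i (Suc i) k \<in> {1..sum_list \<alpha>}"
    using i k by (auto simp: transpose_def)
  then have x: "?x \<in> diagram \<alpha>"
    using T by (intro cell_of_in_diagram)
  have "swap_entries \<alpha> i T ?x = k"
    using T t x by (simp add: swap_entries_def)
  then show ?thesis
    using cell_of_entry[OF U x] by simp
qed

lemma Des_iff:
  "i \<in> Des \<alpha> T \<longleftrightarrow> i \<in> {1..<sum_list \<alpha>} \<and> snd (cell_of \<alpha> T i) \<le> snd (cell_of \<alpha> T (Suc i))"
  by (simp add: Des_def col_of_def)

lemma ADes_iff:
  "i \<in> ADes \<alpha> T \<longleftrightarrow> i \<in> {1..<sum_list \<alpha>} \<and> snd (cell_of \<alpha> T i) \<le> snd (cell_of \<alpha> T (Suc i)) \<and>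
     attacks (cell_of \<alpha> T i) (cell_of \<alpha> T (Suc i))"
  by (auto simp: ADes_def Des_iff)

text \<open>Distinct cells of one column attack each other, which turns the weak inequality of
  \<open>Des\<close> into a strict one.\<close>

lemma nADes_iff:
  assumes T: "T \<in> SCT \<alpha>"
  shows "i \<in> nADes \<alpha> T \<longleftrightarrow> i \<in> {1..<sum_list \<alpha>} \<and>
     snd (cell_of \<alpha> T i) < snd (cell_of \<alpha> T (Suc i)) \<and>
     \<not> attacks (cell_of \<alpha> T i) (cell_of \<alpha> T (Suc i))"
proof -
  have "snd (cell_of \<alpha> T i) \<noteq> snd (cell_of \<alpha> T (Suc i))"
    if "i \<in> {1..<sum_list \<alpha>}" "\<not> attacks (cell_of \<alpha> T i) (cell_of \<alpha> T (Suc i))"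
  proof
    assume "snd (cell_of \<alpha> T i) = snd (cell_of \<alpha> T (Suc i))"
    then have "cell_of \<alpha> T i = cell_of \<alpha> T (Suc i)"
      using that(2) by (cases "cell_of \<alpha> T i"; cases "cell_of \<alpha> T (Suc i)") auto
    then show False
      using that(1) by (simp add: cell_of_inj[OF T])
  qed
  then show ?thesis
    by (auto simp: nADes_def Des_iff ADes_iff)
qed

text \<open>Rows decrease, so \<open>i + 1\<close> cannot stand to the right of \<open>i\<close> in
  the same row; and a cell never attacks one in a column further left.\<close>

lemma nADes_swappable:
  assumes T: "T \<in> SCT \<alpha>" and i: "i \<in> nADes \<alpha> T"
  shows "swappable (cell_of \<alpha> T i) (cell_of \<alpha> T (Suc i))"
proof -
  obtain r q s p where x: "cell_of \<alpha> T i = (r, q)" and y: "cell_of \<alpha> T (Suc i) = (s, p)"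
    by fastforce
  have i': "i \<in> {1..<sum_list \<alpha>}" and qp: "q < p" and na: "\<not> attacks (r, q) (s, p)"
    using i x y by (auto simp: nADes_iff[OF T])
  have d: "(r, q) \<in> diagram \<alpha>" "(s, p) \<in> diagram \<alpha>"
    using cell_of_in_diagram[OF T, of i] cell_of_in_diagram[OF T, of "Suc i"] i' x y by auto
  have "T (r, q) = i" "T (s, p) = Suc i"
    using entry_cell_of[OF T, of i] entry_cell_of[OF T, of "Suc i"] i' x y by auto
  then have "r \<noteq> s"
    using SCT_row[OF T, of r q p] d qp by auto
  then show ?thesis
    using x y qp na by (auto simp: swappable_def)
qed

lemmas nADes_swap_SCT = swap_entries_SCT[OF _ _ nADes_swappable]

text \<open>Both alternatives rest on the absence of an integer strictly between \<open>i\<close>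
  and \<open>i + 1\<close>. In a common row, a cell between the two would hold such an integer. In
  different rows, if \<open>i + 1\<close> attacked \<open>i\<close>, the triple rule would put such
  an integer to the right of \<open>i + 1\<close>.\<close>

lemma nondescent_cases:
  assumes T: "T \<in> SCT \<alpha>" and i: "i \<in> {1..<sum_list \<alpha>}" "i \<notin> Des \<alpha> T"
  shows "(\<exists>r q. cell_of \<alpha> T i = (r, Suc q) \<and> cell_of \<alpha> T (Suc i) = (r, q)) \<or>
         swappable (cell_of \<alpha> T i) (cell_of \<alpha> T (Suc i))"
proof -
  obtain r q s p where x: "cell_of \<alpha> T i = (r, q)" and y: "cell_of \<alpha> T (Suc i) = (s, p)"
    by fastforce
  have pq: "p < q"
    using i x y by (auto simp: Des_iff)
  have d: "(r, q) \<in> diagram \<alpha>" "(s, p) \<in> diagram \<alpha>"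
    using cell_of_in_diagram[OF T, of i] cell_of_in_diagram[OF T, of "Suc i"] i x y by auto
  have e: "T (r, q) = i" "T (s, p) = Suc i"
    using entry_cell_of[OF T, of i] entry_cell_of[OF T, of "Suc i"] i x y by auto
  show ?thesis
  proof (cases "r = s")
    case True
    have "q = Suc p"
    proof (rule ccontr)
      assume "q \<noteq> Suc p"
      then have lt: "p < Suc p" "Suc p < q"
        using pq by auto
      have m: "(r, Suc p) \<in> diagram \<alpha>"
        using diagram_left[OF d(1)] lt by simp
      then show False
        using SCT_row[OF T m d(1) lt(2)] SCT_row[OF T _ m lt(1)] d True e by auto
    qed
    then show ?thesis
      using True x y by simp
  next
    case False
    have "\<not> attacks (s, p) (r, q)"
    proof
      assume "attacks (s, p) (r, q)"
      then have q: "q = Suc p" "s < r"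
        using pq by auto
      then have "(s, q) \<in> diagram \<alpha> \<and> T (r, q) < T (s, q)"
        using SCT_triple[OF T, of r q s] d e by auto
      then show False
        using SCT_row[OF T d(2), of q] pq e by auto
    qed
    then show ?thesis
      using False x y pq by (auto simp: swappable_def)
  qed
qed

lemma swap_entries_swap_entries:
  "T \<in> SCT \<alpha> \<Longrightarrow> swap_entries \<alpha> i (swap_entries \<alpha> i T) = T"
  using SCT_ext[of T \<alpha>] by (auto simp: swap_entries_def fun_eq_iff PiE_def extensional_def)

lemma swap_nondescent_nADes:
  assumes T: "T \<in> SCT \<alpha>" and i: "i \<in> {1..<sum_list \<alpha>}" "i \<notin> Des \<alpha> T"
    and sw: "swappable (cell_of \<alpha> T i) (cell_of \<alpha> T (Suc i))"
  shows "i \<in> nADes \<alpha> (swap_entries \<alpha> i T)"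
proof -
  let ?U = "swap_entries \<alpha> i T"
  have U: "?U \<in> SCT \<alpha>"
    using swap_entries_SCT[OF T i(1) sw] by simp
  have "cell_of \<alpha> ?U i = cell_of \<alpha> T (Suc i)" "cell_of \<alpha> ?U (Suc i) = cell_of \<alpha> T i"
    using cell_of_swap_entries[OF T U i(1)] i(1) by auto
  then show ?thesis
    using i sw by (auto simp: nADes_iff[OF U] Des_iff swappable_def)
qed


subsection \<open>Inversions\<close>

text \<open>Pairs of cells in one column are left out, as their order is constant on an equivalence
  class. With this choice a proper interchange creates one inversion, at the cells of
  \<open>i\<close> and \<open>i + 1\<close>, and changes no other.\<close>

definition invs :: "nat list \<Rightarrow> tableau \<Rightarrow> ((nat \<times> nat) \<times> (nat \<times> nat)) set" where
  "invs \<alpha> T = {(x, y). x \<in> diagram \<alpha> \<and> y \<in> diagram \<alpha> \<and> snd x < snd y \<and> T y < T x}"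

lemma finite_invs: "T \<in> SCT \<alpha> \<Longrightarrow> finite (invs \<alpha> T)"
  by (rule finite_subset[of _ "diagram \<alpha> \<times> diagram \<alpha>"]) (auto simp: invs_def finite_diagram)

lemma card_invs_swap:
  assumes T: "T \<in> SCT \<alpha>" and i: "i \<in> nADes \<alpha> T"
  shows "card (invs \<alpha> (swap_entries \<alpha> i T)) = Suc (card (invs \<alpha> T))"
proof -
  let ?U = "swap_entries \<alpha> i T" and ?x = "cell_of \<alpha> T i" and ?y = "cell_of \<alpha> T (Suc i)"
  have i': "i \<in> {1..<sum_list \<alpha>}" and lt: "snd ?x < snd ?y"
    using i by (auto simp: nADes_iff[OF T])
  have d: "?x \<in> diagram \<alpha>" "?y \<in> diagram \<alpha>"
    using cell_of_in_diagram[OF T] i' by auto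
  have e: "T ?x = i" "T ?y = Suc i"
    using i' T by auto
  have U: "?U ?x = Suc i" "?U ?y = i"
    using d e by (auto simp: swap_entries_def)
  have "invs \<alpha> ?U = insert (?x, ?y) (invs \<alpha> T)"
  proof (rule Set.set_eqI)
    fix z :: "(nat \<times> nat) \<times> (nat \<times> nat)"
    obtain p q where z: "z = (p, q)" by (cases z)
    show "z \<in> invs \<alpha> ?U \<longleftrightarrow> z \<in> insert (?x, ?y) (invs \<alpha> T)"
    proof (cases "p \<in> diagram \<alpha> \<and> q \<in> diagram \<alpha> \<and> {q, p} \<noteq> {?x, ?y}")
      case True
      then show ?thesis
        using swap_entries_less_iff[OF T i', of q p] z by (auto simp: invs_def)
    next
      case False
      then consider "p \<notin> diagram \<alpha> \<or> q \<notin> diagram \<alpha>" | "p = ?x" "q = ?y" | "p = ?y" "q = ?x"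
        by (auto simp: doubleton_eq_iff)
      then show ?thesis
      proof cases
        case 1
        then show ?thesis
          using d unfolding z invs_def by blast
      next
        case 2
        then show ?thesis
          using d U lt by (simp add: z invs_def)
      next
        case 3
        then show ?thesis
          using lt by (auto simp: z invs_def)
      qed
    qed
  qed
  moreover have "(?x, ?y) \<notin> invs \<alpha> T"
    using e by (auto simp: invs_def)
  ultimately show ?thesis
    using finite_invs[OF T] by simp
qed


subsection \<open>Source tableaux\<close>

definition source :: "nat list \<Rightarrow> tableau \<Rightarrow> bool" where
  "source \<alpha> T \<longleftrightarrow> T \<in> SCT \<alpha> \<and> (\<forall>i\<in>{1..<sum_list \<alpha>}. i \<notin> Des \<alpha> T \<longrightarrow>
     (\<exists>r q. cell_of \<alpha> T i = (r, Suc q) \<and> cell_of \<alpha> T (Suc i) = (r, q)))"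

text \<open>A tableau that is not a source has a non-descent whose interchange can be undone, which
  removes one inversion; so every tableau arises by proper interchanges from a source of its class.
  Both premises are restricted to tableaux equivalent to \<open>T\<close>, so \<open>P\<close> may
  depend on the class.\<close>

lemma SCT_source_induct:
  assumes "T \<in> SCT \<alpha>"
    and base: "\<And>U. \<lbrakk>(U, T) \<in> sct_equiv \<alpha>; source \<alpha> U\<rbrakk> \<Longrightarrow> P U"
    and step: "\<And>U i. \<lbrakk>(U, T) \<in> sct_equiv \<alpha>; i \<in> nADes \<alpha> U; P U\<rbrakk> \<Longrightarrow> P (swap_entries \<alpha> i U)"
  shows "P T"
  using assms
proof (induction "card (invs \<alpha> T)" arbitrary: T rule: less_induct)
  case less
  note T = less.prems(1)
  have refl: "(T, T) \<in> sct_equiv \<alpha>"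
    using T by (simp add: sct_equiv_def)
  show ?case
  proof (cases "source \<alpha> T")
    case True
    then show ?thesis
      using less.prems(2) refl by blast
  next
    case False
    then obtain i where i: "i \<in> {1..<sum_list \<alpha>}" "i \<notin> Des \<alpha> T"
      and sw: "swappable (cell_of \<alpha> T i) (cell_of \<alpha> T (Suc i))"
      using T nondescent_cases[OF T] unfolding source_def by blast
    let ?U = "swap_entries \<alpha> i T"
    have U: "?U \<in> SCT \<alpha>" and eq: "(T, ?U) \<in> sct_equiv \<alpha>"
      using swap_entries_SCT[OF T i(1) sw] by auto
    have undo: "swap_entries \<alpha> i ?U = T"
      using T by (rule swap_entries_swap_entries)
    have nad: "i \<in> nADes \<alpha> ?U"
      using swap_nondescent_nADes[OF T i sw] .
    have trans: "(V, T) \<in> sct_equiv \<alpha>" if "(V, ?U) \<in> sct_equiv \<alpha>" for V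
      using that eq equiv_sct_equiv[of \<alpha>] by (meson equivE symE transE)
    have "card (invs \<alpha> ?U) < card (invs \<alpha> T)"
      using card_invs_swap[OF U nad] undo by simp
    then have "P ?U"
      using less.hyps[OF _ U] less.prems(2,3) trans by blast
    then have "P (swap_entries \<alpha> i ?U)"
      using less.prems(3)[OF trans nad] U by (simp add: sct_equiv_def)
    then show ?thesis
      using undo by simp
  qed
qed

text \<open>In a source the column drops by at most one from an entry to the next, because a drop
  happens only at a left neighbour. Hence the walk along the entries from \<open>k\<close> to
  \<open>l\<close> cannot jump over column \<open>q\<close>: just before it first gets left of
  \<open>q\<close>, it stands in column \<open>q\<close> itself.\<close>

lemma source_first_left:
  assumes T: "source \<alpha> T" and kl: "1 \<le> k" "k < l" "l \<le> sum_list \<alpha>"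
    and k: "q \<le> snd (cell_of \<alpha> T k)" and l: "snd (cell_of \<alpha> T l) < q"
  obtains g s p where "k \<le> g" "g < l" "cell_of \<alpha> T g = (s, q)"
    "cell_of \<alpha> T (Suc g) = (s, p)" "Suc p = q"
    "\<And>h. k \<le> h \<Longrightarrow> h \<le> g \<Longrightarrow> q \<le> snd (cell_of \<alpha> T h)"
proof -
  define e where "e = (LEAST e. k < e \<and> snd (cell_of \<alpha> T e) < q)"
  have e: "k < e" "snd (cell_of \<alpha> T e) < q"
    using LeastI[of "\<lambda>e. k < e \<and> snd (cell_of \<alpha> T e) < q" l] kl l unfolding e_def by auto
  have "e \<le> l"
    unfolding e_def using kl l by (intro Least_le) auto
  have before: "q \<le> snd (cell_of \<alpha> T h)" if "k \<le> h" "h < e" for h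
  proof (cases "h = k")
    case False
    then show ?thesis
      using not_less_Least[of h "\<lambda>e. k < e \<and> snd (cell_of \<alpha> T e) < q"] that unfolding e_def
      by auto
  qed (use k in simp)
  obtain g where g: "e = Suc g"
    using e(1) by (cases e) auto
  have "g \<in> {1..<sum_list \<alpha>}"
    using g e(1) \<open>e \<le> l\<close> kl by auto
  moreover have "g \<notin> Des \<alpha> T"
    using before[of g] e g by (auto simp: Des_iff)
  ultimately obtain s p where sp: "cell_of \<alpha> T g = (s, Suc p)" "cell_of \<alpha> T (Suc g) = (s, p)"
    using T by (auto simp: source_def)
  then have "Suc p = q"
    using before[of g] e g by auto
  then show ?thesis
    using that[of g s p] sp g e(1) \<open>e \<le> l\<close> before by auto
qed

text \<open>All entries above \<open>k\<close> occupy the same cells in both tableaux. The cell of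
  \<open>k\<close> in one tableau therefore holds neither \<open>k\<close> nor a larger entry in the
  other.\<close>

lemma last_difference:
  assumes T: "T \<in> SCT \<alpha>" and U: "U \<in> SCT \<alpha>" and "T \<noteq> U"
  obtains k where "k \<in> {1..sum_list \<alpha>}" "cell_of \<alpha> T k \<noteq> cell_of \<alpha> U k"
    "\<And>l. \<lbrakk>k < l; l \<le> sum_list \<alpha>\<rbrakk> \<Longrightarrow> cell_of \<alpha> T l = cell_of \<alpha> U l"
    "T (cell_of \<alpha> U k) < k" "U (cell_of \<alpha> T k) < k"
    "\<And>x. \<lbrakk>x \<in> diagram \<alpha>; k < T x\<rbrakk> \<Longrightarrow> U x = T x"
    "\<And>x. \<lbrakk>x \<in> diagram \<alpha>; k < U x\<rbrakk> \<Longrightarrow> T x = U x"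
proof -
  define A where "A = {k \<in> {1..sum_list \<alpha>}. cell_of \<alpha> T k \<noteq> cell_of \<alpha> U k}"
  have "A \<noteq> {}"
    using SCT_eqI[OF T U] \<open>T \<noteq> U\<close> unfolding A_def by blast
  have "finite A"
    unfolding A_def by simp
  define k where "k = Max A"
  have "k \<in> A"
    unfolding k_def using \<open>A \<noteq> {}\<close> \<open>finite A\<close> by (rule Max_in[rotated])
  then have k: "k \<in> {1..sum_list \<alpha>}" "cell_of \<alpha> T k \<noteq> cell_of \<alpha> U k"
    by (auto simp: A_def)
  have later: "cell_of \<alpha> T l = cell_of \<alpha> U l" if "k < l" "l \<le> sum_list \<alpha>" for l
  proof (rule ccontr)
    assume "cell_of \<alpha> T l \<noteq> cell_of \<alpha> U l"
    then have "l \<in> A"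
      using that by (auto simp: A_def)
    then show False
      using Max_ge[OF \<open>finite A\<close>] that unfolding k_def by force
  qed
  have TU: "U x = T x" if "x \<in> diagram \<alpha>" "k < T x" for x
    using later[OF that(2)] entry_in_range[OF T that(1)] T U that(1)
    by (metis atLeastAtMost_iff cell_of_entry entry_cell_of)
  have UT: "T x = U x" if "x \<in> diagram \<alpha>" "k < U x" for x
    using later[OF that(2)] entry_in_range[OF U that(1)] T U that(1)
    by (metis atLeastAtMost_iff cell_of_entry entry_cell_of)
  have "T (cell_of \<alpha> U k) < k"
    using TU[of "cell_of \<alpha> U k"] k T U cell_of_in_diagram[OF U k(1)]
    by (metis cell_of_entry entry_cell_of less_irrefl linorder_neqE_nat)
  moreover have "U (cell_of \<alpha> T k) < k"
    using UT[of "cell_of \<alpha> T k"] k T U cell_of_in_diagram[OF T k(1)]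
    by (metis cell_of_entry entry_cell_of less_irrefl linorder_neqE_nat)
  ultimately show ?thesis
    using that[OF k later _ _ TU UT] by blast
qed

text \<open>At the last difference \<open>k\<close> the two cells of \<open>k\<close> lie in
  different columns, since in one column their order would violate equivalence. Say \<open>k\<close>
  is further left in \<open>T\<close>, and let \<open>e\<close> be the entry of \<open>T\<close> in
  the cell of \<open>k\<close> in \<open>U\<close>. The walk from \<open>e\<close> to
  \<open>k\<close> in \<open>T\<close> passes some \<open>g < k\<close> in that column with
  \<open>g + 1\<close> as left neighbour. If \<open>g = e\<close>, the left neighbour of
  \<open>k\<close> in \<open>U\<close> exceeds \<open>k\<close>, but it holds \<open>g + 1\<close>
  in \<open>T\<close>. If \<open>g > e\<close>, equivalence makes the entry of \<open>U\<close> in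
  the cell of \<open>g\<close> exceed \<open>k\<close>. Both contradict the agreement above
  \<open>k\<close>.\<close>

lemma source_unique:
  assumes T: "source \<alpha> T" and U: "source \<alpha> U" and eq: "(T, U) \<in> sct_equiv \<alpha>"
  shows "T = U"
proof (rule ccontr)
  assume "T \<noteq> U"
  \<comment> \<open>One-sided claim: \<open>k\<close> sits further left in \<open>T\<close>. The end
    of the proof applies it to the pair in both orders.\<close>
  have left: False
    if T: "source \<alpha> T" and U: "U \<in> SCT \<alpha>" and eq: "(T, U) \<in> sct_equiv \<alpha>"
      and k: "k \<in> {1..sum_list \<alpha>}"
      and lt: "T (cell_of \<alpha> U k) < k"
      and later: "\<And>x. \<lbrakk>x \<in> diagram \<alpha>; k < U x\<rbrakk> \<Longrightarrow> T x = U x"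
      and col: "snd (cell_of \<alpha> T k) < snd (cell_of \<alpha> U k)" for T U k
  proof -
    have T': "T \<in> SCT \<alpha>"
      using T by (simp add: source_def)
    obtain r q where c: "cell_of \<alpha> U k = (r, q)"
      by fastforce
    have d: "(r, q) \<in> diagram \<alpha>" and Uc: "U (r, q) = k"
      using cell_of_in_diagram[OF U k] entry_cell_of[OF U k] c by auto
    define e where "e = T (r, q)"
    have e: "1 \<le> e" "e < k" "cell_of \<alpha> T e = (r, q)"
      using entry_in_range[OF T' d] lt c d T' by (auto simp: e_def)
    obtain g s p where g: "e \<le> g" "g < k" "cell_of \<alpha> T g = (s, q)"
      "cell_of \<alpha> T (Suc g) = (s, p)" "Suc p = q"
    proof -
      have *: "k \<le> sum_list \<alpha>" "q \<le> snd (cell_of \<alpha> T e)" "snd (cell_of \<alpha> T k) < q"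
        using e k col c by auto
      show ?thesis
        by (rule source_first_left[OF T e(1,2) *]) (rule that)
    qed
    have gr: "g \<in> {1..sum_list \<alpha>}" "Suc g \<in> {1..sum_list \<alpha>}"
      using g e k by auto
    have ds: "(s, q) \<in> diagram \<alpha>" "(s, p) \<in> diagram \<alpha>"
      using cell_of_in_diagram[OF T' gr(1)] cell_of_in_diagram[OF T' gr(2)] g by auto
    have Ts: "T (s, q) = g" "T (s, p) = Suc g"
      using entry_cell_of[OF T' gr(1)] entry_cell_of[OF T' gr(2)] g by auto
    show False
    proof (cases "g = e")
      case True
      then have "s = r"
        using g e by simp
      then have "k < U (s, p)"
        using SCT_row[OF U ds(2,1)] g Uc by auto
      then show False
        using later[OF ds(2)] Ts g by auto
    next
      case False
      then have "T (r, q) < T (s, q)"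
        using g Ts by (simp add: e_def)
      then have "k < U (s, q)"
        using sct_equivD[OF eq d ds(1)] Uc by simp
      then show False
        using later[OF ds(1)] Ts g by auto
    qed
  qed
  have T': "T \<in> SCT \<alpha>" and U': "U \<in> SCT \<alpha>"
    using T U by (auto simp: source_def)
  have eq': "(U, T) \<in> sct_equiv \<alpha>"
    using eq equiv_sct_equiv[of \<alpha>] by (meson equivE symE)
  obtain k where k: "k \<in> {1..sum_list \<alpha>}" "cell_of \<alpha> T k \<noteq> cell_of \<alpha> U k"
    and lt: "T (cell_of \<alpha> U k) < k" "U (cell_of \<alpha> T k) < k"
    and later: "\<And>x. \<lbrakk>x \<in> diagram \<alpha>; k < T x\<rbrakk> \<Longrightarrow> U x = T x"
      "\<And>x. \<lbrakk>x \<in> diagram \<alpha>; k < U x\<rbrakk> \<Longrightarrow> T x = U x"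
    using last_difference[OF T' U' \<open>T \<noteq> U\<close>] by metis
  have "snd (cell_of \<alpha> T k) \<noteq> snd (cell_of \<alpha> U k)"
  proof
    assume *: "snd (cell_of \<alpha> T k) = snd (cell_of \<alpha> U k)"
    obtain r s q where rs: "cell_of \<alpha> T k = (r, q)" "cell_of \<alpha> U k = (s, q)"
      using * by (metis prod.collapse)
    have "T (s, q) < T (r, q) \<longleftrightarrow> U (s, q) < U (r, q)"
      using sct_equivD[OF eq, of s q r] cell_of_in_diagram[OF T' k(1)]
        cell_of_in_diagram[OF U' k(1)] rs by auto
    then show False
      using lt rs entry_cell_of[OF T' k(1)] entry_cell_of[OF U' k(1)] by auto
  qed
  then consider "snd (cell_of \<alpha> T k) < snd (cell_of \<alpha> U k)"
    | "snd (cell_of \<alpha> U k) < snd (cell_of \<alpha> T k)"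
    by linarith
  then show False
    using left[OF T U' eq k(1) lt(1) later(2)] left[OF U T' eq' k(1) lt(2) later(1)] by cases auto
qed

text \<open>The class is generated from \<open>T0\<close> by proper interchanges, and each of them
  reverses the order of one pair of cells only. That pair has the smaller entry in the earlier
  column and is not attacking, so every pair reversed against \<open>T0\<close> has these
  properties.\<close>

lemma inversion_from_source:
  assumes T0: "source \<alpha> T0" and eq: "(T0, T) \<in> sct_equiv \<alpha>"
    and "x \<in> diagram \<alpha>" "y \<in> diagram \<alpha>" "T0 x < T0 y" "T y < T x"
  shows "snd x < snd y \<and> \<not> attacks x y"
proof -
  have T: "T \<in> SCT \<alpha>"
    using eq by (simp add: sct_equiv_def)
  have eqT0: "(T0, U) \<in> sct_equiv \<alpha>" if "(U, T) \<in> sct_equiv \<alpha>" for U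
    using that eq equiv_sct_equiv[of \<alpha>] by (meson equivE symE transE)
  have "\<forall>x\<in>diagram \<alpha>. \<forall>y\<in>diagram \<alpha>. T0 x < T0 y \<and> T y < T x \<longrightarrow> snd x < snd y \<and> \<not> attacks x y"
    using T
  proof (rule SCT_source_induct)
    fix U assume "(U, T) \<in> sct_equiv \<alpha>" "source \<alpha> U"
    then have "U = T0"
      using source_unique[OF T0 _ eqT0] by simp
    then show "\<forall>x\<in>diagram \<alpha>. \<forall>y\<in>diagram \<alpha>. T0 x < T0 y \<and> U y < U x
        \<longrightarrow> snd x < snd y \<and> \<not> attacks x y"
      by auto
  next
    fix U i
    assume eqU: "(U, T) \<in> sct_equiv \<alpha>" and i: "i \<in> nADes \<alpha> U"
      and IH: "\<forall>x\<in>diagram \<alpha>. \<forall>y\<in>diagram \<alpha>. T0 x < T0 y \<and> U y < U x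
        \<longrightarrow> snd x < snd y \<and> \<not> attacks x y"
    have U: "U \<in> SCT \<alpha>"
      using eqU by (simp add: sct_equiv_def)
    let ?a = "cell_of \<alpha> U i" and ?b = "cell_of \<alpha> U (Suc i)"
    have i': "i \<in> {1..<sum_list \<alpha>}" "snd ?a < snd ?b" "\<not> attacks ?a ?b"
      using i by (auto simp: nADes_iff[OF U])
    have ab: "?a \<in> diagram \<alpha>" "?b \<in> diagram \<alpha>"
      using cell_of_in_diagram[OF U] i' by auto
    have sab: "swap_entries \<alpha> i U ?a = Suc i" "swap_entries \<alpha> i U ?b = i"
      using U i'(1) ab by (auto simp: swap_entries_def)
    show "\<forall>x\<in>diagram \<alpha>. \<forall>y\<in>diagram \<alpha>. T0 x < T0 y \<and> swap_entries \<alpha> i U y < swap_entries \<alpha> i U x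
        \<longrightarrow> snd x < snd y \<and> \<not> attacks x y"
    proof (intro ballI impI)
      fix x y
      assume xy: "x \<in> diagram \<alpha>" "y \<in> diagram \<alpha>"
        and lt: "T0 x < T0 y \<and> swap_entries \<alpha> i U y < swap_entries \<alpha> i U x"
      show "snd x < snd y \<and> \<not> attacks x y"
      proof (cases "{y, x} = {?a, ?b}")
        case True
        then have "x = ?a \<and> y = ?b"
          using lt sab by (auto simp: doubleton_eq_iff)
        then show ?thesis
          using i' by simp
      next
        case False
        then show ?thesis
          using swap_entries_less_iff[OF U i'(1) xy(2,1)] lt IH xy by blast
      qed
    qed
  qed
  then show ?thesis
    using assms by blast
qed

text \<open>\<open>k\<close> is the last entry on which the two tableaux differ, and \<open>j\<close> the first later entry that
  \<open>k\<close> attacks in the source. The triple rule in the source excludes that the entry \<open>k\<close> of \<open>T\<close>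
  attacks one of \<open>k + 1, \<dots>, j\<close>.\<close>

lemma source_separation:
  assumes T0: "source \<alpha> T0" and eq: "(T0, T) \<in> sct_equiv \<alpha>" and ne: "T \<noteq> T0"
    and des: "Des \<alpha> T \<subseteq> Des \<alpha> T0"
  obtains k j where "1 \<le> k" "k < j" "j \<le> sum_list \<alpha>"
    "\<And>l. \<lbrakk>k < l; l < j\<rbrakk> \<Longrightarrow> snd (cell_of \<alpha> T0 k) < snd (cell_of \<alpha> T0 l) \<and>
       \<not> attacks (cell_of \<alpha> T0 k) (cell_of \<alpha> T0 l)"
    "snd (cell_of \<alpha> T0 k) \<le> snd (cell_of \<alpha> T0 j)" "attacks (cell_of \<alpha> T0 k) (cell_of \<alpha> T0 j)"
    "\<And>l. \<lbrakk>k < l; l \<le> j\<rbrakk> \<Longrightarrow> snd (cell_of \<alpha> T k) < snd (cell_of \<alpha> T l) \<and>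
       \<not> attacks (cell_of \<alpha> T k) (cell_of \<alpha> T l)"
proof -
  let ?n = "sum_list \<alpha>" and ?D = "cell_of \<alpha> T0" and ?C = "cell_of \<alpha> T"
  have T: "T \<in> SCT \<alpha>" and T0': "T0 \<in> SCT \<alpha>"
    using eq by (auto simp: sct_equiv_def)
  obtain k where k: "k \<in> {1..?n}" and later: "\<And>l. \<lbrakk>k < l; l \<le> ?n\<rbrakk> \<Longrightarrow> ?D l = ?C l"
    and lt: "T0 (?C k) < k" "T (?D k) < k"
    using last_difference[OF T0' T ne[symmetric]] by metis
  obtain r q where x: "?D k = (r, q)" by fastforce
  obtain r' q' where c: "?C k = (r', q')" by fastforce
  have dx: "(r, q) \<in> diagram \<alpha>" and dc: "(r', q') \<in> diagram \<alpha>"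
    using cell_of_in_diagram[OF T0' k] cell_of_in_diagram[OF T k] x c by auto
  have ex: "T0 (r, q) = k" and ec: "T (r', q') = k"
    using entry_cell_of[OF T0' k] entry_cell_of[OF T k] x c by auto
  \<comment> \<open>The cells of \<open>k\<close> in \<open>T\<close> and in \<open>T0\<close> are
    in opposite order in the two tableaux, since in each the cell of \<open>k\<close> in the other
    holds a smaller entry.\<close>
  have qq: "q' < q" and na: "\<not> attacks (r', q') (r, q)"
    using inversion_from_source[OF T0 eq dc dx] lt x c ex ec by auto
  have "1 \<le> q'"
    using diagram_pos[OF dc] .
  then have dl: "(r, q - 1) \<in> diagram \<alpha>"
    using diagram_left[OF dx] qq by simp
  \<comment> \<open>The left neighbour of \<open>k\<close> in \<open>T0\<close>. It is larger than
    \<open>k\<close> and lies left of column \<open>q\<close>, so the entries from \<open>k\<close>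
    to \<open>m\<close> have to leave the columns from \<open>q\<close> on.\<close>
  define m where "m = T0 (r, q - 1)"
  have km: "k < m" and mn: "m \<le> ?n" and Cm: "?D m = (r, q - 1)"
    using SCT_row[OF T0' dl dx] entry_in_range[OF T0' dl] T0' dl ex qq by (auto simp: m_def)
  obtain g s p where g: "k \<le> g" "g < m" "?D g = (s, q)" "?D (Suc g) = (s, p)" "Suc p = q"
    and right: "\<And>h. k \<le> h \<Longrightarrow> h \<le> g \<Longrightarrow> q \<le> snd (?D h)"
  proof -
    have *: "1 \<le> k" "q \<le> snd (?D k)" "snd (?D m) < q"
      using k x Cm qq by auto
    show ?thesis
      by (rule source_first_left[OF T0 *(1) km mn *(2,3)]) (rule that)
  qed
  \<comment> \<open>Here the inclusion of descent sets enters. If \<open>g = k\<close>, then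
    \<open>k\<close> is a non-descent of \<open>T0\<close>, hence of \<open>T\<close>. But
    \<open>k + 1\<close> stands in column \<open>q - 1\<close> in both tableaux, and in
    \<open>T\<close> the entry \<open>k\<close> is in column \<open>q' \<le> q - 1\<close>, which
    makes it a descent.\<close>
  have kg: "k < g"
  proof (rule ccontr)
    assume "\<not> k < g"
    then have gk: "g = k"
      using g by simp
    then have "k \<notin> Des \<alpha> T0"
      using g x by (auto simp: Des_iff)
    then have "k \<notin> Des \<alpha> T"
      using des by blast
    moreover have "?C (Suc k) = (s, p)"
      using later[of "Suc k"] g gk km mn by simp
    ultimately show False
      using c g qq km mn k by (auto simp: Des_iff)
  qed
  have gn: "g \<in> {1..?n}"
    using kg g mn by auto
  have "?D g \<noteq> ?D k"
    using cell_of_inj[OF T0' gn k] kg by simp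
  then have attg: "attacks (?D k) (?D g)"
    using g x by auto
  \<comment> \<open>The entry \<open>g\<close> shares column \<open>q\<close> with \<open>k\<close>
    and is therefore attacked, so the minimum exists; \<open>j \<le> g\<close> keeps the entries up
    to \<open>j\<close> in columns from \<open>q\<close> on.\<close>
  define j where "j = (LEAST j. k < j \<and> attacks (?D k) (?D j))"
  have j: "k < j" "attacks (?D k) (?D j)"
    using LeastI[of "\<lambda>j. k < j \<and> attacks (?D k) (?D j)" g] kg attg unfolding j_def by auto
  have jg: "j \<le> g"
    unfolding j_def using kg attg by (intro Least_le) auto
  have first: "\<not> attacks (?D k) (?D l)" if "k < l" "l < j" for l
    using not_less_Least[of l "\<lambda>j. k < j \<and> attacks (?D k) (?D j)"] that unfolding j_def by auto
  have "m \<notin> {k..g}"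
    using right[of m] Cm qq by auto
  then have gm: "g < m"
    using km by simp
  show ?thesis
  proof (rule that[of k j])
    show "1 \<le> k" "k < j" "j \<le> ?n" "attacks (?D k) (?D j)" "snd (?D k) \<le> snd (?D j)"
      using k j jg gn right[of j] x by auto
    fix l assume l: "k < l"
    {
      assume "l < j"
      then have "q \<le> snd (?D l)" "\<not> attacks (?D k) (?D l)"
        using right[of l] jg l first by auto
      \<comment> \<open>Another cell of column \<open>q\<close> would be attacked by
        \<open>k\<close>, so the column of \<open>l\<close> is strictly larger.\<close>
      moreover have "?D l \<noteq> ?D k"
        using cell_of_inj[OF T0' _ k, of l] l k \<open>l < j\<close> jg gn by simp
      ultimately show "snd (?D k) < snd (?D l) \<and> \<not> attacks (?D k) (?D l)"
        using x by (cases "?D l") auto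
    next
      assume lj: "l \<le> j"
      have ln: "l \<in> {1..?n}"
        using l lj jg gn by auto
      have Cl: "?C l = ?D l"
        using later[of l] l ln by simp
      obtain s' p' where C0l: "?D l = (s', p')" by fastforce
      have dl': "(s', p') \<in> diagram \<alpha>" and el: "T0 (s', p') = l"
        using cell_of_in_diagram[OF T0' ln] entry_cell_of[OF T0' ln] C0l by auto
      have qp: "q \<le> p'"
        using right[of l] l lj jg C0l by auto
      have "\<not> attacks (r', q') (s', p')"
      proof
        assume "attacks (r', q') (s', p')"
        then have *: "p' = q" "q' = q - 1" "r' < s'"
          using qq qp by auto
        \<comment> \<open>The cell \<open>(r', q - 1)\<close> does not attack \<open>(r, q)\<close>,
          so \<open>r \<le> r' < s'\<close>. Since \<open>l < m\<close>, the triple rule in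
          \<open>T0\<close> for \<open>(s', q)\<close> and \<open>(r, q - 1)\<close> gives
          \<open>l < k\<close>.\<close>
        have "\<not> r' < r"
          using na * qq by auto
        then have "T0 (s', q) < T0 (r, q)"
          using SCT_triple[OF T0', of s' q r] dl' dl * el lj jg gm by (auto simp: m_def)
        then show False
          using el ex l * by simp
      qed
      then show "snd (?C k) < snd (?C l) \<and> \<not> attacks (?C k) (?C l)"
        using c Cl C0l qq qp by simp
    }
  qed
qed


subsection \<open>The operators on tableaux satisfy the Hecke relations\<close>

text \<open>For the cells \<open>x\<close> and \<open>y\<close> of \<open>i\<close> and \<open>i + 1\<close>, these are the three cases in the definition
  of the action of \<open>\<pi>\<^sub>i\<close>.\<close>

definition fixing :: "nat \<times> nat \<Rightarrow> nat \<times> nat \<Rightarrow> bool" where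
  "fixing x y \<longleftrightarrow> snd y < snd x"

definition killing :: "nat \<times> nat \<Rightarrow> nat \<times> nat \<Rightarrow> bool" where
  "killing x y \<longleftrightarrow> snd x \<le> snd y \<and> attacks x y"

definition raising :: "nat \<times> nat \<Rightarrow> nat \<times> nat \<Rightarrow> bool" where
  "raising x y \<longleftrightarrow> snd x < snd y \<and> \<not> attacks x y"

lemma fixing_killing_raising:
  assumes "x \<noteq> y"
  obtains "fixing x y" | "killing x y" | "raising x y"
proof -
  have "attacks x y" if "snd x = snd y"
    using assms that by (cases x; cases y) simp
  then have "fixing x y \<or> killing x y \<or> raising x y"
    unfolding fixing_def killing_def raising_def by linarith
  then show thesis
    using that by blast
qed

lemma raising_imp_fixing: "raising x y \<Longrightarrow> fixing y x"
  by (simp add: fixing_def raising_def)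

abbreviation basis :: "'a \<Rightarrow> 'a \<Rightarrow>\<^sub>0 complex" where
  "basis T \<equiv> Poly_Mapping.single T 1"

lemma clin_pi_op: "clin (pi_op \<alpha> i)"
  unfolding pi_op_def by (rule clin_lin_ext)

lemma pi_op_basis: "pi_op \<alpha> i (basis T) = pi_tab \<alpha> i T"
  by (simp add: pi_op_def)

lemma pi_op_fixing:
  "fixing (cell_of \<alpha> T i) (cell_of \<alpha> T (Suc i)) \<Longrightarrow> pi_op \<alpha> i (basis T) = basis T"
  by (simp add: pi_op_basis pi_tab_def nADes_def ADes_iff Des_iff fixing_def)

lemma pi_op_killing:
  "\<lbrakk>i \<in> {1..<sum_list \<alpha>}; killing (cell_of \<alpha> T i) (cell_of \<alpha> T (Suc i))\<rbrakk>
     \<Longrightarrow> pi_op \<alpha> i (basis T) = 0"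
  by (simp add: pi_op_basis pi_tab_def ADes_iff killing_def)

lemma raising_iff_nADes:
  "\<lbrakk>T \<in> SCT \<alpha>; i \<in> {1..<sum_list \<alpha>}\<rbrakk>
     \<Longrightarrow> raising (cell_of \<alpha> T i) (cell_of \<alpha> T (Suc i)) \<longleftrightarrow> i \<in> nADes \<alpha> T"
  by (auto simp: nADes_iff raising_def)

lemma pi_op_raising:
  "\<lbrakk>i \<in> {1..<sum_list \<alpha>}; raising (cell_of \<alpha> T i) (cell_of \<alpha> T (Suc i))\<rbrakk>
     \<Longrightarrow> pi_op \<alpha> i (basis T) = basis (swap_entries \<alpha> i T)"
  by (auto simp: pi_op_basis pi_tab_def nADes_def ADes_iff Des_iff raising_def)

lemma swap_raising_SCT:
  "\<lbrakk>T \<in> SCT \<alpha>; i \<in> {1..<sum_list \<alpha>}; raising (cell_of \<alpha> T i) (cell_of \<alpha> T (Suc i))\<rbrakk>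
     \<Longrightarrow> swap_entries \<alpha> i T \<in> SCT \<alpha>"
  using nADes_swap_SCT(1) raising_iff_nADes by blast

lemma cell_of_swap_raising:
  "\<lbrakk>T \<in> SCT \<alpha>; i \<in> {1..<sum_list \<alpha>}; raising (cell_of \<alpha> T i) (cell_of \<alpha> T (Suc i));
     k \<in> {1..sum_list \<alpha>}\<rbrakk>
     \<Longrightarrow> cell_of \<alpha> (swap_entries \<alpha> i T) k = cell_of \<alpha> T (transpose i (Suc i) k)"
  using swap_raising_SCT cell_of_swap_entries by blast

text \<open>With a case split on the pairs of cells that meet, these rules evaluate the operator
  words below on a basis vector: each factor fixes, kills or interchanges, and the cells after an
  interchange are read off by a transposition.\<close>

lemmas pi_op_simps = pi_op_fixing pi_op_killing pi_op_raising clin_zero[OF clin_pi_op]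
  swap_raising_SCT cell_of_swap_raising raising_imp_fixing

lemma pi_op_idem_basis:
  assumes T: "T \<in> SCT \<alpha>" and i: "i \<in> {1..<sum_list \<alpha>}"
  shows "pi_op \<alpha> i (pi_op \<alpha> i (basis T)) = pi_op \<alpha> i (basis T)"
proof -
  have "cell_of \<alpha> T i \<noteq> cell_of \<alpha> T (Suc i)"
    using i by (simp add: cell_of_inj[OF T])
  then show ?thesis
    using T i by (cases rule: fixing_killing_raising) (simp_all add: pi_op_simps)
qed

lemma pi_op_commute_basis:
  assumes T: "T \<in> SCT \<alpha>" and i: "i \<in> {1..<sum_list \<alpha>}" and j: "j \<in> {1..<sum_list \<alpha>}"
    and ij: "Suc i < j \<or> Suc j < i"
  shows "pi_op \<alpha> i (pi_op \<alpha> j (basis T)) = pi_op \<alpha> j (pi_op \<alpha> i (basis T))"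
proof -
  have swap: "swap_entries \<alpha> i (swap_entries \<alpha> j T) = swap_entries \<alpha> j (swap_entries \<alpha> i T)"
    using ij by (auto simp: swap_entries_def fun_eq_iff transpose_def)
  have tr: "transpose i (Suc i) j = j" "transpose i (Suc i) (Suc j) = Suc j"
    "transpose j (Suc j) i = i" "transpose j (Suc j) (Suc i) = Suc i"
    using ij by (auto simp: transpose_def)
  have "cell_of \<alpha> T i \<noteq> cell_of \<alpha> T (Suc i)" "cell_of \<alpha> T j \<noteq> cell_of \<alpha> T (Suc j)"
    using i j by (simp_all add: cell_of_inj[OF T])
  then show ?thesis
    using T i j swap tr
    by (elim fixing_killing_raising) (simp_all add: pi_op_simps)
qed

text \<open>Both sides depend only on how the pairs \<open>a b\<close>, \<open>a c\<close> and
  \<open>b c\<close> behave, which leaves 27 combinations. In three of them the two sides would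
  differ; these cannot occur, because the column of \<open>a\<close> would be both smaller and
  larger than that of \<open>c\<close>.\<close>

lemma pi_op_braid_basis:
  assumes T: "T \<in> SCT \<alpha>" and i: "i \<in> {1..<sum_list \<alpha>}" and j: "Suc i \<in> {1..<sum_list \<alpha>}"
  shows "pi_op \<alpha> i (pi_op \<alpha> (Suc i) (pi_op \<alpha> i (basis T))) =
         pi_op \<alpha> (Suc i) (pi_op \<alpha> i (pi_op \<alpha> (Suc i) (basis T)))"
proof -
  have swap: "swap_entries \<alpha> i (swap_entries \<alpha> (Suc i) (swap_entries \<alpha> i T)) =
        swap_entries \<alpha> (Suc i) (swap_entries \<alpha> i (swap_entries \<alpha> (Suc i) T))"
    by (auto simp: swap_entries_def fun_eq_iff transpose_def)
  have tr: "transpose i (Suc i) (Suc (Suc i)) = Suc (Suc i)"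
    "transpose (Suc i) (Suc (Suc i)) i = i"
    by (auto simp: transpose_def)
  define a b c where abc: "a = cell_of \<alpha> T i" "b = cell_of \<alpha> T (Suc i)"
    "c = cell_of \<alpha> T (Suc (Suc i))"
  note defs = abc[symmetric]
  have "a \<noteq> b" "a \<noteq> c" "b \<noteq> c"
    using i j by (simp_all add: abc cell_of_inj[OF T])
  moreover have "False" if "killing a b" "raising b c" "fixing a c"
    using that by (auto simp: fixing_def killing_def raising_def)
  moreover have "False" if "raising a b" "killing b c" "fixing a c"
    using that by (auto simp: fixing_def killing_def raising_def)
  moreover have "False" if "raising a b" "raising b c" "fixing a c"
    using that by (auto simp: fixing_def killing_def raising_def)
  ultimately show ?thesis
    using T i j swap tr
    by (elim fixing_killing_raising) (simp_all add: pi_op_simps defs)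
qed

section \<open>Spans of tableau sets that are stable under the operators\<close>

definition tab_span :: "tableau set \<Rightarrow> (tableau \<Rightarrow>\<^sub>0 complex) set" where
  "tab_span S = {v. Poly_Mapping.keys v \<subseteq> S}"

text \<open>One notion that covers \<open>SCT \<alpha>\<close>, where the Hecke relations are
  checked, and each equivalence class, whose span is the module.\<close>

definition swap_closed :: "nat list \<Rightarrow> tableau set \<Rightarrow> bool" where
  "swap_closed \<alpha> S \<longleftrightarrow> S \<subseteq> SCT \<alpha> \<and> (\<forall>T\<in>S. \<forall>i\<in>nADes \<alpha> T. swap_entries \<alpha> i T \<in> S)"

lemma tab_span_zero: "0 \<in> tab_span S"
  by (simp add: tab_span_def)

lemma tab_span_add: "u \<in> tab_span S \<Longrightarrow> v \<in> tab_span S \<Longrightarrow> u + v \<in> tab_span S"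
  using keys_add[of u v] by (auto simp: tab_span_def)

lemma tab_span_cscale: "v \<in> tab_span S \<Longrightarrow> cscale c v \<in> tab_span S"
  using keys_cscale[of c v] by (auto simp: tab_span_def)

lemma tab_span_uminus: "v \<in> tab_span S \<Longrightarrow> - v \<in> tab_span S"
  using tab_span_cscale[of v S "- 1"] by simp

lemma tab_span_sum: "(\<And>x. x \<in> A \<Longrightarrow> h x \<in> tab_span S) \<Longrightarrow> sum h A \<in> tab_span S"
  by (induction A rule: infinite_finite_induct) (auto simp: tab_span_zero tab_span_add)

lemma tab_span_lin_ext:
  "(\<And>b. b \<in> Poly_Mapping.keys p \<Longrightarrow> f b \<in> tab_span S) \<Longrightarrow> lin_ext f p \<in> tab_span S"
  unfolding lin_ext_def by (intro tab_span_sum tab_span_cscale)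

lemma tab_span_mono: "S \<subseteq> S' \<Longrightarrow> tab_span S \<subseteq> tab_span S'"
  by (auto simp: tab_span_def)

lemma swap_closed_SCT: "swap_closed \<alpha> (SCT \<alpha>)"
  using nADes_swap_SCT(1) by (auto simp: swap_closed_def nADes_iff)

lemma swap_closed_class:
  assumes E: "E \<in> sct_classes \<alpha>"
  shows "swap_closed \<alpha> E"
proof -
  obtain T where T: "T \<in> SCT \<alpha>" and ET: "E = sct_equiv \<alpha> `` {T}"
    using E by (auto simp: sct_classes_def elim: quotientE)
  have "swap_entries \<alpha> i U \<in> E" if U: "U \<in> E" and i: "i \<in> nADes \<alpha> U" for U i
  proof -
    have TU: "(T, U) \<in> sct_equiv \<alpha>" and U': "U \<in> SCT \<alpha>"
      using U by (auto simp: ET sct_equiv_def)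
    then have "(U, swap_entries \<alpha> i U) \<in> sct_equiv \<alpha>"
      using nADes_swap_SCT(2)[OF U' _ U' i] i by (simp add: nADes_iff[OF U'])
    then show ?thesis
      using TU equiv_sct_equiv[of \<alpha>] unfolding ET by (metis Image_singleton_iff equivE transE)
  qed
  moreover have "E \<subseteq> SCT \<alpha>"
    by (auto simp: ET sct_equiv_def)
  ultimately show ?thesis
    unfolding swap_closed_def by blast
qed

lemma pi_tab_in_span:
  assumes "swap_closed \<alpha> S" "T \<in> S"
  shows "pi_tab \<alpha> i T \<in> tab_span S"
  using assms by (auto simp: pi_tab_def tab_span_def swap_closed_def)

lemma pi_op_in_span:
  assumes "swap_closed \<alpha> S" "v \<in> tab_span S"
  shows "pi_op \<alpha> i v \<in> tab_span S"
  unfolding pi_op_def using assms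
  by (intro tab_span_lin_ext pi_tab_in_span) (auto simp: tab_span_def)

lemma pi_op_idem:
  assumes "i \<in> {1..<sum_list \<alpha>}" "v \<in> tab_span (SCT \<alpha>)"
  shows "pi_op \<alpha> i (pi_op \<alpha> i v) = pi_op \<alpha> i v"
  by (rule clin_eqI[OF clin_comp[OF clin_pi_op clin_pi_op] clin_pi_op], rule pi_op_idem_basis)
    (use assms in \<open>auto simp: tab_span_def\<close>)

lemma pi_op_commute:
  assumes "i \<in> {1..<sum_list \<alpha>}" "j \<in> {1..<sum_list \<alpha>}" "Suc i < j \<or> Suc j < i"
    and "v \<in> tab_span (SCT \<alpha>)"
  shows "pi_op \<alpha> i (pi_op \<alpha> j v) = pi_op \<alpha> j (pi_op \<alpha> i v)"
  by (rule clin_eqI[OF clin_comp[OF clin_pi_op clin_pi_op] clin_comp[OF clin_pi_op clin_pi_op]],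
      rule pi_op_commute_basis)
    (use assms in \<open>auto simp: tab_span_def\<close>)

lemma pi_op_braid:
  assumes "i \<in> {1..<sum_list \<alpha>}" "Suc i \<in> {1..<sum_list \<alpha>}" "v \<in> tab_span (SCT \<alpha>)"
  shows "pi_op \<alpha> i (pi_op \<alpha> (Suc i) (pi_op \<alpha> i v)) =
         pi_op \<alpha> (Suc i) (pi_op \<alpha> i (pi_op \<alpha> (Suc i) v))"
proof -
  have clin3: "clin (\<lambda>v. pi_op \<alpha> i (pi_op \<alpha> j (pi_op \<alpha> k v)))" for i j k
    by (rule clin_comp[OF clin_pi_op clin_comp[OF clin_pi_op clin_pi_op]])
  show ?thesis
    by (rule clin_eqI[OF clin3 clin3], rule pi_op_braid_basis)
      (use assms in \<open>auto simp: tab_span_def\<close>)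
qed


subsection \<open>The action of the free algebra\<close>

lemma clin_foldr_pi_op: "clin (foldr (pi_op \<alpha>) js)"
proof (induction js)
  case Nil
  show ?case by (simp add: clin_def)
next
  case (Cons i js)
  then show ?case
    using clin_comp[OF clin_pi_op[of \<alpha> i] Cons] by (simp add: comp_def)
qed

lemma foldr_pi_op_in_span:
  "\<lbrakk>swap_closed \<alpha> S; v \<in> tab_span S\<rbrakk> \<Longrightarrow> foldr (pi_op \<alpha>) js v \<in> tab_span S"
  by (induction js) (auto intro: pi_op_in_span)

lemma clin_free_act_left: "clin (\<lambda>p. free_act \<alpha> p v)"
  unfolding free_act_def by (rule clin_lin_ext)

lemma clin_free_act: "clin (free_act \<alpha> p)"
proof (rule clinI)
  fix u v :: "tableau \<Rightarrow>\<^sub>0 complex" and c :: complex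
  show "free_act \<alpha> p (u + v) = free_act \<alpha> p u + free_act \<alpha> p v"
    by (simp add: free_act_def lin_ext_def clin_add[OF clin_foldr_pi_op] cscale_add_right sum.distrib)
  show "free_act \<alpha> p (cscale c v) = cscale c (free_act \<alpha> p v)"
    by (rule poly_mapping_eqI)
      (simp add: free_act_def lookup_lin_ext clin_scale[OF clin_foldr_pi_op] sum_distrib_left
        mult.left_commute)
qed

lemma free_act_zero: "free_act \<alpha> p 0 = 0"
  by (rule clin_zero[OF clin_free_act])

lemma free_act_zero_left: "free_act \<alpha> 0 v = 0"
  by (rule clin_zero[OF clin_free_act_left])

lemma free_act_add_left: "free_act \<alpha> (p + q) v = free_act \<alpha> p v + free_act \<alpha> q v"
  by (rule clin_add[OF clin_free_act_left])

lemma free_act_uminus_left: "free_act \<alpha> (- p) v = - free_act \<alpha> p v"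
  by (rule clin_uminus[OF clin_free_act_left])

lemma free_act_diff_left: "free_act \<alpha> (p - q) v = free_act \<alpha> p v - free_act \<alpha> q v"
  by (rule clin_diff[OF clin_free_act_left])

lemma free_act_in_span:
  "\<lbrakk>swap_closed \<alpha> S; v \<in> tab_span S\<rbrakk> \<Longrightarrow> free_act \<alpha> p v \<in> tab_span S"
  unfolding free_act_def by (intro tab_span_lin_ext foldr_pi_op_in_span)

lemma free_act_single: "free_act \<alpha> (Poly_Mapping.single w c) v = cscale c (foldr (pi_op \<alpha>) (letters w) v)"
  by (simp add: free_act_def)

text \<open>Both sides are linear in \<open>p\<close> and in \<open>q\<close>, which reduces the
  claim to two words; there it says that \<open>foldr\<close> over a concatenation is a composition,
  the right-hand word acting first.\<close>

lemma free_act_mult: "free_act \<alpha> (p * q) v = free_act \<alpha> p (free_act \<alpha> q v)"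
proof -
  have basis: "free_act \<alpha> (basis u * q) v = free_act \<alpha> (basis u) (free_act \<alpha> q v)" for u
  proof (rule clin_eqI[of "\<lambda>q. free_act \<alpha> (basis u * q) v"])
    have "clin (\<lambda>q :: word \<Rightarrow>\<^sub>0 complex. basis u * q)"
      by (rule clinI) (simp_all add: distrib_left cscale_conv_mult mult.assoc[symmetric] mult_single)
    then show "clin (\<lambda>q. free_act \<alpha> (basis u * q) v)"
      by (rule clin_comp[OF clin_free_act_left])
    show "clin (\<lambda>q. free_act \<alpha> (basis u) (free_act \<alpha> q v))"
      by (rule clin_comp[OF clin_free_act clin_free_act_left])
    show "free_act \<alpha> (basis u * basis w) v = free_act \<alpha> (basis u) (free_act \<alpha> (basis w) v)" for w
      by (simp add: mult_single free_act_single plus_word_def)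
  qed
  show ?thesis
  proof (rule clin_eqI[of "\<lambda>p. free_act \<alpha> (p * q) v" _ p])
    have "clin (\<lambda>p :: word \<Rightarrow>\<^sub>0 complex. p * q)"
      by (rule clinI) (simp_all add: distrib_right cscale_conv_mult mult.assoc)
    then show "clin (\<lambda>p. free_act \<alpha> (p * q) v)"
      by (rule clin_comp[OF clin_free_act_left])
  qed (rule clin_free_act_left, rule basis)
qed

lemma free_act_gen: "free_act \<alpha> (gen i) v = pi_op \<alpha> i v"
  by (simp add: gen_def free_act_single)

lemma free_act_scalar: "free_act \<alpha> (Poly_Mapping.single 0 c) v = cscale c v"
  by (simp add: free_act_single zero_word_def)

lemma free_act_one: "free_act \<alpha> 1 v = v"
  using free_act_scalar[of \<alpha> 1 v] by simp

section \<open>The ring structure of the free algebra, and the vanishing of the relation ideal on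
  tableaux\<close>

lemma free_alg_simps [simp]:
  "mult (free_alg n) = (*)" "one (free_alg n) = 1" "zero (free_alg n) = 0" "add (free_alg n) = (+)"
  by (simp_all add: free_alg_def)

lemma carrier_free_alg:
  "p \<in> carrier (free_alg n) \<longleftrightarrow> (\<forall>w\<in>Poly_Mapping.keys p. set (letters w) \<subseteq> {1..<n})"
  by (simp add: free_alg_def)

lemma free_alg_add_closed:
  "p \<in> carrier (free_alg n) \<Longrightarrow> q \<in> carrier (free_alg n) \<Longrightarrow> p + q \<in> carrier (free_alg n)"
  using keys_add[of p q] by (auto simp: carrier_free_alg)

lemma free_alg_uminus_closed: "p \<in> carrier (free_alg n) \<Longrightarrow> - p \<in> carrier (free_alg n)"
  using keys_cscale[of "- 1" p] by (auto simp: carrier_free_alg)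

lemma free_alg_diff_closed:
  "p \<in> carrier (free_alg n) \<Longrightarrow> q \<in> carrier (free_alg n) \<Longrightarrow> p - q \<in> carrier (free_alg n)"
  using free_alg_add_closed[of p n "- q"] free_alg_uminus_closed[of q n] by simp

lemma free_alg_mult_closed:
  assumes "p \<in> carrier (free_alg n)" "q \<in> carrier (free_alg n)"
  shows "p * q \<in> carrier (free_alg n)"
proof -
  have "set (letters w) \<subseteq> {1..<n}" if w: "w \<in> Poly_Mapping.keys (p * q)" for w
  proof -
    obtain a b where "w = a + b" "a \<in> Poly_Mapping.keys p" "b \<in> Poly_Mapping.keys q"
      using w keys_mult[of p q] by blast
    then show ?thesis
      using assms by (auto simp: carrier_free_alg plus_word_def)
  qed
  then show ?thesis
    by (simp add: carrier_free_alg)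
qed

lemma free_alg_scalar_closed: "Poly_Mapping.single 0 c \<in> carrier (free_alg n)"
  by (auto simp: carrier_free_alg zero_word_def)

lemma free_alg_gen_closed: "i \<in> {1..<n} \<Longrightarrow> gen i \<in> carrier (free_alg n)"
  by (simp add: carrier_free_alg gen_def)

lemma ring_free_alg: "ring (free_alg n)"
proof (rule ringI)
  show "abelian_group (free_alg n)"
  proof (rule abelian_groupI)
    fix p assume "p \<in> carrier (free_alg n)"
    then show "\<exists>q\<in>carrier (free_alg n). q \<oplus>\<^bsub>free_alg n\<^esub> p = \<zero>\<^bsub>free_alg n\<^esub>"
      by (intro bexI[of _ "- p"]) (simp_all add: free_alg_uminus_closed)
  next
    show "\<zero>\<^bsub>free_alg n\<^esub> \<in> carrier (free_alg n)"
      by (simp add: carrier_free_alg)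
  qed (simp_all add: free_alg_add_closed add.assoc add.commute)
  show "Group.monoid (free_alg n)"
    using free_alg_scalar_closed[of 1 n]
    by (intro monoidI) (simp_all add: free_alg_mult_closed mult.assoc)
qed (simp_all add: algebra_simps)

lemma hecke_rels_closed: "hecke_rels n \<subseteq> carrier (free_alg n)"
  unfolding hecke_rels_def
  by (auto intro!: free_alg_diff_closed free_alg_mult_closed free_alg_gen_closed)

lemma hecke_rels_act_zero:
  assumes p: "p \<in> hecke_rels (sum_list \<alpha>)" and v: "v \<in> tab_span (SCT \<alpha>)"
  shows "free_act \<alpha> p v = 0"
proof -
  from p consider i where "i \<in> {1..<sum_list \<alpha>}" "p = gen i * gen i - gen i"
    | i where "i \<in> {1..<sum_list \<alpha>}" "Suc i \<in> {1..<sum_list \<alpha>}"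
      "p = gen i * gen (Suc i) * gen i - gen (Suc i) * gen i * gen (Suc i)"
    | i j where "i \<in> {1..<sum_list \<alpha>}" "j \<in> {1..<sum_list \<alpha>}" "\<bar>int i - int j\<bar> \<ge> 2"
      "p = gen i * gen j - gen j * gen i"
    unfolding hecke_rels_def by auto
  then show ?thesis
  proof cases
    case 1
    then show ?thesis
      using pi_op_idem[OF _ v] by (simp add: free_act_diff_left free_act_mult free_act_gen)
  next
    case 2
    then show ?thesis
      using pi_op_braid[OF _ _ v] by (simp add: free_act_diff_left free_act_mult free_act_gen)
  next
    case 3
    moreover have "Suc i < j \<or> Suc j < i"
      using 3 by linarith
    ultimately show ?thesis
      using pi_op_commute[OF _ _ _ v, of i j] by (simp add: free_act_diff_left free_act_mult free_act_gen)
  qed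
qed

lemma hecke_ideal_acts_zero:
  assumes p: "p \<in> Idl\<^bsub>free_alg (sum_list \<alpha>)\<^esub> (hecke_rels (sum_list \<alpha>))" and v: "v \<in> tab_span (SCT \<alpha>)"
  shows "free_act \<alpha> p v = 0"
proof -
  interpret R: ring "free_alg (sum_list \<alpha>)"
    by (rule ring_free_alg)
  \<comment> \<open>The annihilator of the whole span rather than of the given \<open>v\<close>: the
    annihilator of one vector is in general only a left ideal. Closure under right multiplication
    uses that the span is stable.\<close>
  define K where "K = {p \<in> carrier (free_alg (sum_list \<alpha>)). \<forall>v\<in>tab_span (SCT \<alpha>). free_act \<alpha> p v = 0}"
  have neg: "- p \<in> K" and inv: "\<ominus>\<^bsub>free_alg (sum_list \<alpha>)\<^esub> p = - p" if "p \<in> K" for p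
  proof -
    show "- p \<in> K"
      using that by (auto simp: K_def free_alg_uminus_closed free_act_uminus_left)
    then show "\<ominus>\<^bsub>free_alg (sum_list \<alpha>)\<^esub> p = - p"
      using that by (intro R.minus_equality) (auto simp: K_def)
  qed
  have "ideal K (free_alg (sum_list \<alpha>))"
  proof (rule idealI)
    show "subgroup K (add_monoid (free_alg (sum_list \<alpha>)))"
    proof (rule R.add.subgroupI)
      show "K \<noteq> {}"
        using R.zero_closed by (auto simp: K_def free_act_zero_left)
      show "\<ominus>\<^bsub>free_alg (sum_list \<alpha>)\<^esub> p \<in> K" if "p \<in> K" for p
        using neg inv that by simp
    qed (auto simp: K_def free_alg_add_closed free_act_add_left)
    show "p \<otimes>\<^bsub>free_alg (sum_list \<alpha>)\<^esub> a \<in> K" if "a \<in> K" "p \<in> carrier (free_alg (sum_list \<alpha>))" for a p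
      using that by (auto simp: K_def free_act_mult free_alg_mult_closed free_act_zero)
    show "a \<otimes>\<^bsub>free_alg (sum_list \<alpha>)\<^esub> p \<in> K" if "a \<in> K" "p \<in> carrier (free_alg (sum_list \<alpha>))" for a p
      using that free_act_in_span[OF swap_closed_SCT]
      by (auto simp: K_def free_act_mult free_alg_mult_closed)
  qed (rule ring_free_alg)
  moreover have "hecke_rels (sum_list \<alpha>) \<subseteq> K"
    using hecke_rels_closed hecke_rels_act_zero by (auto simp: K_def)
  ultimately have "Idl\<^bsub>free_alg (sum_list \<alpha>)\<^esub> (hecke_rels (sum_list \<alpha>)) \<subseteq> K"
    by (rule R.genideal_minimal)
  then show ?thesis
    using p v by (auto simp: K_def)
qed


subsection \<open>Raising an entry\<close>

text \<open>The tableau reached along the word \<open>rev [k..<k + d]\<close> if every factor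
  interchanges. After \<open>d\<close> interchanges the original cell of \<open>k\<close> holds
  \<open>k + d\<close>, hence the index of the next one.\<close>

fun raise_entry :: "nat list \<Rightarrow> nat \<Rightarrow> nat \<Rightarrow> tableau \<Rightarrow> tableau" where
  "raise_entry \<alpha> k 0 T = T"
| "raise_entry \<alpha> k (Suc d) T = swap_entries \<alpha> (k + d) (raise_entry \<alpha> k d T)"

text \<open>The entries above \<open>k + d\<close> have not moved yet, so the next factor compares
  the original cell of \<open>k\<close> with the original cell of \<open>k + d + 1\<close>. This is
  why the hypothesis can be stated in \<open>T\<close> alone.\<close>

lemma raise_entry:
  assumes T: "T \<in> SCT \<alpha>" and k: "1 \<le> k"
    and raising: "\<And>l. \<lbrakk>k < l; l \<le> k + d\<rbrakk> \<Longrightarrow> raising (cell_of \<alpha> T k) (cell_of \<alpha> T l)"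
    and d: "k + d \<le> sum_list \<alpha>"
  shows raise_entry_SCT: "raise_entry \<alpha> k d T \<in> SCT \<alpha>"
    and cell_of_raise_entry: "cell_of \<alpha> (raise_entry \<alpha> k d T) (k + d) = cell_of \<alpha> T k"
    and cell_of_raise_entry_above: "\<lbrakk>k + d < l; l \<le> sum_list \<alpha>\<rbrakk>
      \<Longrightarrow> cell_of \<alpha> (raise_entry \<alpha> k d T) l = cell_of \<alpha> T l"
    and foldr_pi_op_raise: "foldr (pi_op \<alpha>) (rev [k..<k + d]) (basis T) = basis (raise_entry \<alpha> k d T)"
proof -
  have "raise_entry \<alpha> k d T \<in> SCT \<alpha> \<and> cell_of \<alpha> (raise_entry \<alpha> k d T) (k + d) = cell_of \<alpha> T k \<and>
      (\<forall>l. k + d < l \<and> l \<le> sum_list \<alpha> \<longrightarrow> cell_of \<alpha> (raise_entry \<alpha> k d T) l = cell_of \<alpha> T l) \<and>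
      foldr (pi_op \<alpha>) (rev [k..<k + d]) (basis T) = basis (raise_entry \<alpha> k d T)"
    using raising d
  proof (induction d)
    case 0
    then show ?case using T by simp
  next
    case (Suc d)
    let ?U = "raise_entry \<alpha> k d T"
    have U: "?U \<in> SCT \<alpha>" and Uk: "cell_of \<alpha> ?U (k + d) = cell_of \<alpha> T k"
      and Ul: "\<And>l. \<lbrakk>k + d < l; l \<le> sum_list \<alpha>\<rbrakk> \<Longrightarrow> cell_of \<alpha> ?U l = cell_of \<alpha> T l"
      and fold: "foldr (pi_op \<alpha>) (rev [k..<k + d]) (basis T) = basis ?U"
      using Suc by auto
    have i: "k + d \<in> {1..<sum_list \<alpha>}"
      using Suc.prems k by simp
    have r: "raising (cell_of \<alpha> ?U (k + d)) (cell_of \<alpha> ?U (Suc (k + d)))"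
      using Suc.prems Uk Ul[of "Suc (k + d)"] by simp
    have "cell_of \<alpha> (swap_entries \<alpha> (k + d) ?U) (Suc (k + d)) = cell_of \<alpha> T k"
      using cell_of_swap_raising[OF U i r, of "Suc (k + d)"] Uk i by simp
    moreover have "cell_of \<alpha> (swap_entries \<alpha> (k + d) ?U) l = cell_of \<alpha> T l"
      if "Suc (k + d) < l" "l \<le> sum_list \<alpha>" for l
      using cell_of_swap_raising[OF U i r, of l] Ul[of l] that by (simp add: transpose_def)
    moreover have "foldr (pi_op \<alpha>) (rev [k..<k + Suc d]) (basis T) = basis (swap_entries \<alpha> (k + d) ?U)"
      using fold pi_op_raising[OF i r] by simp
    ultimately show ?case
      using swap_raising_SCT[OF U i r] by simp
  qed
  then show "raise_entry \<alpha> k d T \<in> SCT \<alpha>"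
    "cell_of \<alpha> (raise_entry \<alpha> k d T) (k + d) = cell_of \<alpha> T k"
    "\<lbrakk>k + d < l; l \<le> sum_list \<alpha>\<rbrakk> \<Longrightarrow> cell_of \<alpha> (raise_entry \<alpha> k d T) l = cell_of \<alpha> T l"
    "foldr (pi_op \<alpha>) (rev [k..<k + d]) (basis T) = basis (raise_entry \<alpha> k d T)"
    by auto
qed

lemma foldr_pi_op_raise_killing:
  assumes T: "T \<in> SCT \<alpha>" and kj: "1 \<le> k" "k < j" "j \<le> sum_list \<alpha>"
    and raising: "\<And>l. \<lbrakk>k < l; l < j\<rbrakk> \<Longrightarrow> raising (cell_of \<alpha> T k) (cell_of \<alpha> T l)"
    and killing: "killing (cell_of \<alpha> T k) (cell_of \<alpha> T j)"
  shows "foldr (pi_op \<alpha>) (rev [k..<j]) (basis T) = 0"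
proof -
  \<comment> \<open>The number of factors before the last one; the last factor meets the cell of
    \<open>k\<close> and the cell of \<open>j\<close>.\<close>
  define d where "d = j - 1 - k"
  have j: "j = Suc (k + d)"
    using kj by (simp add: d_def)
  have r: "\<And>l. \<lbrakk>k < l; l \<le> k + d\<rbrakk> \<Longrightarrow> raising (cell_of \<alpha> T k) (cell_of \<alpha> T l)"
    and n: "k + d \<le> sum_list \<alpha>" and i: "k + d \<in> {1..<sum_list \<alpha>}"
    using raising j kj by auto
  let ?U = "raise_entry \<alpha> k d T"
  have "killing (cell_of \<alpha> ?U (k + d)) (cell_of \<alpha> ?U (Suc (k + d)))"
    using cell_of_raise_entry[OF T kj(1) r n] cell_of_raise_entry_above[OF T kj(1) r n, of j]
      killing j kj by simp
  then have "pi_op \<alpha> (k + d) (basis ?U) = 0"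
    using pi_op_killing[OF i] by blast
  then show ?thesis
    using foldr_pi_op_raise[OF T kj(1) r n] j by simp
qed

section \<open>The filtration by the number of inversions, and top coefficients\<close>

definition inv_le :: "nat list \<Rightarrow> nat \<Rightarrow> tableau set" where
  "inv_le \<alpha> L = {T \<in> SCT \<alpha>. card (invs \<alpha> T) \<le> L}"

lemma pi_tab_inv_le:
  assumes "T \<in> inv_le \<alpha> L"
  shows "pi_tab \<alpha> i T \<in> tab_span (inv_le \<alpha> (Suc L))"
proof -
  have T: "T \<in> SCT \<alpha>" "card (invs \<alpha> T) \<le> L"
    using assms by (auto simp: inv_le_def)
  have "swap_entries \<alpha> i T \<in> inv_le \<alpha> (Suc L)" if "i \<in> nADes \<alpha> T"
    using that T card_invs_swap[OF T(1) that] swap_closed_SCT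
    by (auto simp: inv_le_def swap_closed_def)
  then show ?thesis
    using T by (auto simp: pi_tab_def tab_span_def inv_le_def)
qed

lemma pi_op_inv_le:
  "v \<in> tab_span (inv_le \<alpha> L) \<Longrightarrow> pi_op \<alpha> i v \<in> tab_span (inv_le \<alpha> (Suc L))"
  unfolding pi_op_def by (intro tab_span_lin_ext pi_tab_inv_le) (auto simp: tab_span_def)

text \<open>No other tableau of the support contributes to this coefficient. One that is
  interchanged to the same result equals \<open>T\<close>, as the interchange is an involution; one
  that is fixed has at most \<open>L\<close> inversions, whereas the result has
  \<open>L + 1\<close>.\<close>

lemma lookup_pi_op_top:
  assumes v: "v \<in> tab_span (inv_le \<alpha> L)"
    and T: "T \<in> SCT \<alpha>" "card (invs \<alpha> T) = L" and i: "i \<in> nADes \<alpha> T"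
  shows "Poly_Mapping.lookup (pi_op \<alpha> i v) (swap_entries \<alpha> i T) = Poly_Mapping.lookup v T"
proof -
  let ?S = "swap_entries \<alpha> i T"
  have coeff: "Poly_Mapping.lookup (pi_tab \<alpha> i U) ?S = (if U = T then 1 else 0)"
    if U: "U \<in> Poly_Mapping.keys v" for U
  proof -
    have U': "U \<in> SCT \<alpha>" "card (invs \<alpha> U) \<le> L"
      using U v by (auto simp: tab_span_def inv_le_def)
    consider "i \<in> ADes \<alpha> U" | "i \<in> nADes \<alpha> U" "i \<notin> ADes \<alpha> U" | "i \<notin> Des \<alpha> U"
      by (auto simp: nADes_def)
    then show ?thesis
    proof cases
      case 1
      then show ?thesis
        using i by (auto simp: pi_tab_def nADes_def)
    next
      case 2
      have "swap_entries \<alpha> i U = ?S \<longleftrightarrow> U = T"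
        using swap_entries_swap_entries[OF T(1), of i] swap_entries_swap_entries[OF U'(1), of i]
        by metis
      then show ?thesis
        using 2 by (auto simp: pi_tab_def lookup_single)
    next
      case 3
      then have "U \<noteq> T"
        using i by (auto simp: nADes_def)
      moreover have "U \<noteq> ?S"
        using card_invs_swap[OF T(1) i] T(2) U'(2) by auto
      ultimately show ?thesis
        using 3 by (auto simp: pi_tab_def nADes_def ADes_def lookup_single)
    qed
  qed
  have "Poly_Mapping.lookup (pi_op \<alpha> i v) ?S =
      (\<Sum>U\<in>Poly_Mapping.keys v. if U = T then Poly_Mapping.lookup v U else 0)"
    unfolding pi_op_def lookup_lin_ext by (intro sum.cong) (auto simp: coeff)
  also have "\<dots> = Poly_Mapping.lookup v T"
    by (auto simp: in_keys_iff)
  finally show ?thesis .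
qed

lemma lookup_foldr_pi_op_top:
  assumes v: "v \<in> tab_span (inv_le \<alpha> (card (invs \<alpha> T)))" and T: "T \<in> SCT \<alpha>" and k: "1 \<le> k"
    and raising: "\<And>l. \<lbrakk>k < l; l \<le> k + d\<rbrakk> \<Longrightarrow> raising (cell_of \<alpha> T k) (cell_of \<alpha> T l)"
    and d: "k + d \<le> sum_list \<alpha>"
  shows "Poly_Mapping.lookup (foldr (pi_op \<alpha>) (rev [k..<k + d]) v) (raise_entry \<alpha> k d T) =
    Poly_Mapping.lookup v T"
proof -
  \<comment> \<open>The induction also carries the filtration bound: each factor raises it by one,
    and the inversions of the raised tableau grow at the same rate, so that tableau stays at the
    top.\<close>
  have "Poly_Mapping.lookup (foldr (pi_op \<alpha>) (rev [k..<k + d]) v) (raise_entry \<alpha> k d T) =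
      Poly_Mapping.lookup v T \<and>
    foldr (pi_op \<alpha>) (rev [k..<k + d]) v \<in> tab_span (inv_le \<alpha> (card (invs \<alpha> (raise_entry \<alpha> k d T))))"
    using raising d
  proof (induction d)
    case 0
    then show ?case using v by simp
  next
    case (Suc d)
    let ?U = "raise_entry \<alpha> k d T"
    have r: "\<And>l. \<lbrakk>k < l; l \<le> k + d\<rbrakk> \<Longrightarrow> raising (cell_of \<alpha> T k) (cell_of \<alpha> T l)"
      and n: "k + d \<le> sum_list \<alpha>" and i: "k + d \<in> {1..<sum_list \<alpha>}"
      using Suc.prems k by auto
    have U: "?U \<in> SCT \<alpha>"
      by (rule raise_entry_SCT[OF T k r n])
    have "raising (cell_of \<alpha> ?U (k + d)) (cell_of \<alpha> ?U (Suc (k + d)))"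
      using cell_of_raise_entry[OF T k r n]
        cell_of_raise_entry_above[OF T k r n, of "Suc (k + d)"] Suc.prems by simp
    then have nad: "k + d \<in> nADes \<alpha> ?U"
      using raising_iff_nADes[OF U i] by simp
    let ?v = "foldr (pi_op \<alpha>) (rev [k..<k + d]) v"
    have IH: "Poly_Mapping.lookup ?v ?U = Poly_Mapping.lookup v T"
      "?v \<in> tab_span (inv_le \<alpha> (card (invs \<alpha> ?U)))"
      using Suc.IH[OF r n] by auto
    show ?case
      using lookup_pi_op_top[OF IH(2) U refl nad] pi_op_inv_le[OF IH(2), of "k + d"] IH(1)
        card_invs_swap[OF U nad] by simp
  qed
  then show ?thesis by blast
qed


subsection \<open>Images of the source tableau\<close>

text \<open>A proper interchange moves \<open>i\<close> into the column further right, and a tableau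
  that is fixed has \<open>i\<close> as a non-descent already.\<close>

lemma keys_pi_op_nondescent:
  assumes v: "v \<in> tab_span (SCT \<alpha>)" and i: "i \<in> {1..<sum_list \<alpha>}"
    and T: "T \<in> Poly_Mapping.keys (pi_op \<alpha> i v)"
  shows "i \<notin> Des \<alpha> T"
proof -
  obtain U where U: "U \<in> SCT \<alpha>" "T \<in> Poly_Mapping.keys (pi_tab \<alpha> i U)"
    using T v keys_lin_ext[of "pi_tab \<alpha> i" v] unfolding pi_op_def tab_span_def by blast
  consider "i \<in> nADes \<alpha> U" "T = swap_entries \<alpha> i U" | "i \<notin> Des \<alpha> U" "T = U"
    using U(2) by (auto simp: pi_tab_def nADes_def split: if_splits)
  then show ?thesis
  proof cases
    case 1
    then have r: "raising (cell_of \<alpha> U i) (cell_of \<alpha> U (Suc i))"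
      using raising_iff_nADes[OF U(1) i] by simp
    then show ?thesis
      using cell_of_swap_raising[OF U(1) i r] i 1(2) by (auto simp: Des_iff raising_def)
  qed simp
qed

lemma class_equiv:
  "\<lbrakk>E \<in> sct_classes \<alpha>; T \<in> E; U \<in> E\<rbrakk> \<Longrightarrow> (T, U) \<in> sct_equiv \<alpha>"
  unfolding sct_classes_def using equiv_sct_equiv by (metis quotient_eq_iff)

lemma class_in_SCT: "E \<in> sct_classes \<alpha> \<Longrightarrow> E \<subseteq> SCT \<alpha>"
  using swap_closed_class by (auto simp: swap_closed_def)

lemma class_mem:
  "\<lbrakk>E \<in> sct_classes \<alpha>; T \<in> E; (U, T) \<in> sct_equiv \<alpha>\<rbrakk> \<Longrightarrow> U \<in> E"
  unfolding sct_classes_def using equiv_sct_equiv[of \<alpha>]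
  by (metis equivE in_quotient_imp_closed symE)

lemma class_source:
  assumes E: "E \<in> sct_classes \<alpha>"
  obtains T0 where "T0 \<in> E" "source \<alpha> T0"
proof -
  obtain T where T: "T \<in> E"
    using E equiv_sct_equiv by (metis ex_in_conv in_quotient_imp_non_empty sct_classes_def)
  have "\<exists>T0\<in>E. source \<alpha> T0"
    by (rule SCT_source_induct[of T \<alpha> "\<lambda>_. \<exists>T0\<in>E. source \<alpha> T0"])
      (use T class_in_SCT[OF E] class_mem[OF E T] in auto)
  then show thesis
    using that by blast
qed

lemma source_generates:
  assumes T0: "source \<alpha> T0" and eq: "(T0, T) \<in> sct_equiv \<alpha>"
  obtains ws where "set ws \<subseteq> {1..<sum_list \<alpha>}" "foldr (pi_op \<alpha>) ws (basis T0) = basis T"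
proof -
  have T: "T \<in> SCT \<alpha>"
    using eq by (simp add: sct_equiv_def)
  have "\<exists>ws. set ws \<subseteq> {1..<sum_list \<alpha>} \<and> foldr (pi_op \<alpha>) ws (basis T0) = basis T"
    using T
  proof (rule SCT_source_induct)
    fix U assume U: "(U, T) \<in> sct_equiv \<alpha>" "source \<alpha> U"
    then have "(T0, U) \<in> sct_equiv \<alpha>"
      using eq equiv_sct_equiv[of \<alpha>] by (meson equivE symE transE)
    then have "U = T0"
      using source_unique[OF T0 U(2)] by simp
    then show "\<exists>ws. set ws \<subseteq> {1..<sum_list \<alpha>} \<and> foldr (pi_op \<alpha>) ws (basis T0) = basis U"
      by (intro exI[of _ "[]"]) simp
  next
    fix U i
    assume U: "(U, T) \<in> sct_equiv \<alpha>" and i: "i \<in> nADes \<alpha> U"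
      and "\<exists>ws. set ws \<subseteq> {1..<sum_list \<alpha>} \<and> foldr (pi_op \<alpha>) ws (basis T0) = basis U"
    then obtain ws where ws: "set ws \<subseteq> {1..<sum_list \<alpha>}" "foldr (pi_op \<alpha>) ws (basis T0) = basis U"
      by blast
    have "U \<in> SCT \<alpha>" and i': "i \<in> {1..<sum_list \<alpha>}"
      using U i by (auto simp: sct_equiv_def nADes_def Des_iff)
    then have "pi_op \<alpha> i (basis U) = basis (swap_entries \<alpha> i U)"
      using pi_op_raising raising_iff_nADes i by blast
    then show "\<exists>ws. set ws \<subseteq> {1..<sum_list \<alpha>} \<and> foldr (pi_op \<alpha>) ws (basis T0) = basis (swap_entries \<alpha> i U)"
      using ws i' by (intro exI[of _ "i # ws"]) simp
  qed
  then show thesis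
    using that by blast
qed

text \<open>The assumptions \<open>fixed\<close> and \<open>killed\<close> are relations that
  \<open>T0\<close> satisfies and that every endomorphism passes on to its image; \<open>v\<close>
  stands for that image.\<close>

lemma source_image_multiple:
  assumes E: "E \<in> sct_classes \<alpha>" and T0: "source \<alpha> T0" "T0 \<in> E" and v: "v \<in> tab_span E"
    and fixed: "\<And>i. \<lbrakk>i \<in> {1..<sum_list \<alpha>}; i \<notin> Des \<alpha> T0\<rbrakk> \<Longrightarrow> pi_op \<alpha> i v = v"
    and killed: "\<And>ws. \<lbrakk>set ws \<subseteq> {1..<sum_list \<alpha>}; foldr (pi_op \<alpha>) ws (basis T0) = 0\<rbrakk>
      \<Longrightarrow> foldr (pi_op \<alpha>) ws v = 0"
  shows "v = cscale (Poly_Mapping.lookup v T0) (basis T0)"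
proof (rule ccontr)
  let ?a = "Poly_Mapping.lookup v T0"
  \<comment> \<open>Removing the term of \<open>T0\<close> guarantees that a tableau with the most
    inversions differs from \<open>T0\<close>. The word to be found annihilates both
    \<open>v\<close> and \<open>basis T0\<close>, hence also \<open>u\<close>.\<close>
  define u where "u = v - cscale ?a (basis T0)"
  assume "v \<noteq> cscale ?a (basis T0)"
  then have "u \<noteq> 0"
    by (simp add: u_def)
  have lookup_u: "Poly_Mapping.lookup u T = (if T = T0 then 0 else Poly_Mapping.lookup v T)" for T
    by (simp add: u_def lookup_minus lookup_single)
  let ?len = "\<lambda>T. card (invs \<alpha> T)"
  define L where "L = Max (?len ` Poly_Mapping.keys u)"
  have fin: "finite (?len ` Poly_Mapping.keys u)"
    by simp
  have "?len ` Poly_Mapping.keys u \<noteq> {}"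
    using \<open>u \<noteq> 0\<close> by (metis image_is_empty keys_eq_empty)
  then have "L \<in> ?len ` Poly_Mapping.keys u"
    unfolding L_def using Max_in[OF fin] by simp
  then obtain T where Tu: "T \<in> Poly_Mapping.keys u" and L: "L = ?len T"
    by blast
  have max: "?len U \<le> ?len T" if "U \<in> Poly_Mapping.keys u" for U
    using Max_ge[OF fin, of "?len U"] that L unfolding L_def by simp
  have Tv: "T \<in> Poly_Mapping.keys v" "T \<noteq> T0"
    using Tu lookup_u[of T] by (auto simp: in_keys_iff split: if_splits)
  have TE: "T \<in> E"
    using Tv v by (auto simp: tab_span_def)
  have T: "T \<in> SCT \<alpha>" and T0': "T0 \<in> SCT \<alpha>"
    using TE T0 class_in_SCT[OF E] by auto
  have v': "v \<in> tab_span (SCT \<alpha>)"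
    using v tab_span_mono[OF class_in_SCT[OF E]] by blast
  have des: "Des \<alpha> T \<subseteq> Des \<alpha> T0"
  proof
    fix i assume i: "i \<in> Des \<alpha> T"
    then have i': "i \<in> {1..<sum_list \<alpha>}"
      by (simp add: Des_iff)
    show "i \<in> Des \<alpha> T0"
    proof (rule ccontr)
      assume "i \<notin> Des \<alpha> T0"
      then have "pi_op \<alpha> i v = v"
        using fixed i' by blast
      then show False
        using keys_pi_op_nondescent[OF v' i', of T] Tv i by simp
    qed
  qed
  obtain k j where kj: "1 \<le> k" "k < j" "j \<le> sum_list \<alpha>"
    and r0: "\<And>l. \<lbrakk>k < l; l < j\<rbrakk> \<Longrightarrow> raising (cell_of \<alpha> T0 k) (cell_of \<alpha> T0 l)"
    and k0: "killing (cell_of \<alpha> T0 k) (cell_of \<alpha> T0 j)"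
    and r: "\<And>l. \<lbrakk>k < l; l \<le> j\<rbrakk> \<Longrightarrow> raising (cell_of \<alpha> T k) (cell_of \<alpha> T l)"
    by (rule source_separation[OF T0(1) class_equiv[OF E T0(2) TE] Tv(2) des])
      (simp add: raising_def killing_def)
  let ?w = "rev [k..<j]"
  have zero0: "foldr (pi_op \<alpha>) ?w (basis T0) = 0"
    using foldr_pi_op_raise_killing[OF T0' kj r0 k0] .
  then have "foldr (pi_op \<alpha>) ?w v = 0"
    using kj by (intro killed) auto
  then have "foldr (pi_op \<alpha>) ?w u = 0"
    unfolding u_def clin_diff[OF clin_foldr_pi_op] clin_scale[OF clin_foldr_pi_op] zero0 by simp
  moreover have "u \<in> tab_span (inv_le \<alpha> (?len T))"
  proof -
    have "Poly_Mapping.keys u \<subseteq> SCT \<alpha>"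
      using v' lookup_u by (auto simp: tab_span_def in_keys_iff split: if_splits)
    then show ?thesis
      using max by (auto simp: tab_span_def inv_le_def)
  qed
  ultimately have "Poly_Mapping.lookup u T = 0"
    using lookup_foldr_pi_op_top[of u \<alpha> T k "j - k"] T kj r by simp
  then show False
    using Tu by (simp add: in_keys_iff)
qed


subsection \<open>The module of an equivalence class\<close>

lemma S_module_simps [simp]:
  "carrier (S_module \<alpha> E) = tab_span E" "zero (S_module \<alpha> E) = 0" "add (S_module \<alpha> E) = (+)"
  by (simp_all add: S_module_def tab_span_def)

section \<open>The 0-Hecke algebra as a quotient, and the action of its cosets\<close>

abbreviation hecke_ideal :: "nat \<Rightarrow> (word \<Rightarrow>\<^sub>0 complex) set" where
  "hecke_ideal n \<equiv> Idl\<^bsub>free_alg n\<^esub> (hecke_rels n)"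

abbreviation hecke_class :: "nat \<Rightarrow> (word \<Rightarrow>\<^sub>0 complex) \<Rightarrow> (word \<Rightarrow>\<^sub>0 complex) set" where
  "hecke_class n p \<equiv> hecke_ideal n +>\<^bsub>free_alg n\<^esub> p"

lemma ideal_hecke_ideal: "ideal (hecke_ideal n) (free_alg n)"
  by (rule ring.genideal_ideal[OF ring_free_alg hecke_rels_closed])

lemma ring_hecke0: "ring (hecke0 n)"
  unfolding hecke0_def by (rule ideal.quotient_is_ring[OF ideal_hecke_ideal])

lemma hecke_class_closed: "p \<in> carrier (free_alg n) \<Longrightarrow> hecke_class n p \<in> carrier (hecke0 n)"
  unfolding hecke0_def by (rule ring_hom_closed[OF ideal.rcos_ring_hom[OF ideal_hecke_ideal]])

lemma carrier_hecke0E: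
  assumes "X \<in> carrier (hecke0 n)"
  obtains p where "p \<in> carrier (free_alg n)" "X = hecke_class n p"
  using assms unfolding hecke0_def FactRing_simps by auto

lemma hecke_class_hom:
  assumes "p \<in> carrier (free_alg n)" "q \<in> carrier (free_alg n)"
  shows "hecke_class n p \<oplus>\<^bsub>hecke0 n\<^esub> hecke_class n q = hecke_class n (p + q)"
    and "hecke_class n p \<otimes>\<^bsub>hecke0 n\<^esub> hecke_class n q = hecke_class n (p * q)"
  using ring_hom_add[OF ideal.rcos_ring_hom[OF ideal_hecke_ideal] assms]
    ring_hom_mult[OF ideal.rcos_ring_hom[OF ideal_hecke_ideal] assms]
  by (simp_all add: hecke0_def)

lemma hecke0_one: "\<one>\<^bsub>hecke0 n\<^esub> = hecke_class n 1"
  by (simp add: hecke0_def FactRing_def)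

text \<open>Two representatives of a coset differ by an element of the ideal, which acts as zero on
  the span of \<open>SCT \<alpha>\<close>. So \<open>the_elem\<close> is applied to a
  singleton.\<close>

lemma smult_hecke_class:
  assumes p: "p \<in> carrier (free_alg (sum_list \<alpha>))" and v: "v \<in> tab_span (SCT \<alpha>)"
  shows "hecke_class (sum_list \<alpha>) p \<odot>\<^bsub>S_module \<alpha> E\<^esub> v = free_act \<alpha> p v"
proof -
  interpret I: ideal "hecke_ideal (sum_list \<alpha>)" "free_alg (sum_list \<alpha>)"
    by (rule ideal_hecke_ideal)
  have "free_act \<alpha> q v = free_act \<alpha> p v" if "q \<in> hecke_class (sum_list \<alpha>) p" for q
  proof -
    obtain h where "h \<in> hecke_ideal (sum_list \<alpha>)" "q = h + p"
      using \<open>q \<in> _\<close> by (auto simp: a_r_coset_def r_coset_def)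
    then show ?thesis
      using hecke_ideal_acts_zero[OF _ v] by (simp add: free_act_add_left)
  qed
  moreover have "p \<in> hecke_class (sum_list \<alpha>) p"
    by (rule I.a_rcos_self[OF p])
  ultimately have "(\<lambda>q. free_act \<alpha> q v) ` hecke_class (sum_list \<alpha>) p = {free_act \<alpha> p v}"
    by blast
  then show ?thesis
    by (simp add: S_module_def)
qed

lemma left_module_S_module:
  assumes E: "E \<in> sct_classes \<alpha>"
  shows "left_module (hecke0 (sum_list \<alpha>)) (S_module \<alpha> E)"
proof -
  let ?H = "hecke0 (sum_list \<alpha>)" and ?M = "S_module \<alpha> E" and ?F = "free_alg (sum_list \<alpha>)"
  have SCT: "v \<in> tab_span (SCT \<alpha>)" if "v \<in> tab_span E" for v
    using that tab_span_mono[OF class_in_SCT[OF E]] by blast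
  note act = smult_hecke_class[OF _ SCT, where E = E]
  have closed: "free_act \<alpha> p v \<in> tab_span E" if "v \<in> tab_span E" for p v
    using free_act_in_span[OF swap_closed_class[OF E] that] .
  have "abelian_group ?M"
  proof (rule abelian_groupI)
    fix x assume "x \<in> carrier ?M"
    then show "\<exists>y\<in>carrier ?M. y \<oplus>\<^bsub>?M\<^esub> x = \<zero>\<^bsub>?M\<^esub>"
      by (intro bexI[of _ "- x"]) (auto intro: tab_span_uminus)
  qed (auto simp: tab_span_zero tab_span_add add.assoc add.commute)
  moreover have "left_module_axioms ?H ?M"
  proof
    fix X v assume X: "X \<in> carrier ?H" and "v \<in> carrier ?M"
    then have v: "v \<in> tab_span E" by simp
    obtain p where p: "p \<in> carrier ?F" "X = hecke_class (sum_list \<alpha>) p"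
      using X by (rule carrier_hecke0E)
    show "X \<odot>\<^bsub>?M\<^esub> v \<in> carrier ?M"
      using act[OF p(1) v] closed[OF v] p(2) by simp
    show "X \<odot>\<^bsub>?M\<^esub> (v \<oplus>\<^bsub>?M\<^esub> u) = X \<odot>\<^bsub>?M\<^esub> v \<oplus>\<^bsub>?M\<^esub> X \<odot>\<^bsub>?M\<^esub> u" if "u \<in> carrier ?M" for u
      using that v p act[OF p(1)] by (simp add: tab_span_add clin_add[OF clin_free_act])
    fix Y assume Y: "Y \<in> carrier ?H"
    obtain q where q: "q \<in> carrier ?F" "Y = hecke_class (sum_list \<alpha>) q"
      using Y by (rule carrier_hecke0E)
    show "(X \<oplus>\<^bsub>?H\<^esub> Y) \<odot>\<^bsub>?M\<^esub> v = X \<odot>\<^bsub>?M\<^esub> v \<oplus>\<^bsub>?M\<^esub> Y \<odot>\<^bsub>?M\<^esub> v"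
      using p q v act by (simp add: hecke_class_hom free_alg_add_closed free_act_add_left)
    show "(X \<otimes>\<^bsub>?H\<^esub> Y) \<odot>\<^bsub>?M\<^esub> v = X \<odot>\<^bsub>?M\<^esub> (Y \<odot>\<^bsub>?M\<^esub> v)"
      using p q v act closed by (simp add: hecke_class_hom free_alg_mult_closed free_act_mult)
  next
    fix v assume "v \<in> carrier ?M"
    then show "\<one>\<^bsub>?H\<^esub> \<odot>\<^bsub>?M\<^esub> v = v"
      using act[of 1 v] free_alg_scalar_closed[of 1 "sum_list \<alpha>"]
      by (simp add: hecke0_one free_act_one)
  qed
  ultimately show ?thesis
    using ring_hecke0 by (intro left_module.intro)
qed

lemma scalar_in_module_End:
  assumes E: "E \<in> sct_classes \<alpha>"
  shows "(\<lambda>v\<in>carrier (S_module \<alpha> E). cscale c v) \<in> module_End (hecke0 (sum_list \<alpha>)) (S_module \<alpha> E)"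
proof -
  have SCT: "v \<in> tab_span (SCT \<alpha>)" if "v \<in> tab_span E" for v
    using that tab_span_mono[OF class_in_SCT[OF E]] by blast
  have "cscale c (X \<odot>\<^bsub>S_module \<alpha> E\<^esub> v) = X \<odot>\<^bsub>S_module \<alpha> E\<^esub> cscale c v \<and>
      X \<odot>\<^bsub>S_module \<alpha> E\<^esub> v \<in> tab_span E"
    if X: "X \<in> carrier (hecke0 (sum_list \<alpha>))" and v: "v \<in> tab_span E" for X v
  proof -
    obtain p where p: "p \<in> carrier (free_alg (sum_list \<alpha>))" "X = hecke_class (sum_list \<alpha>) p"
      using X by (rule carrier_hecke0E)
    show ?thesis
      using smult_hecke_class[OF p(1) SCT] v tab_span_cscale[OF v, of c] p(2)
        free_act_in_span[OF swap_closed_class[OF E] v, of p]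
      by (simp add: clin_scale[OF clin_free_act])
  qed
  then show ?thesis
    by (auto simp: module_End_def tab_span_add tab_span_cscale cscale_add_right)
qed

lemma module_End_scalar:
  assumes E: "E \<in> sct_classes \<alpha>" and f: "f \<in> module_End (hecke0 (sum_list \<alpha>)) (S_module \<alpha> E)"
  obtains c where "f = (\<lambda>v\<in>carrier (S_module \<alpha> E). cscale c v)"
proof -
  have f_closed: "f v \<in> tab_span E" if "v \<in> tab_span E" for v
    using f that by (auto simp: module_End_def)
  have f_add: "f (u + v) = f u + f v" if "u \<in> tab_span E" "v \<in> tab_span E" for u v
    using f that by (auto simp: module_End_def)
  have SCT: "v \<in> tab_span (SCT \<alpha>)" if "v \<in> tab_span E" for v
    using that tab_span_mono[OF class_in_SCT[OF E]] by blast
  have f_act: "f (free_act \<alpha> p v) = free_act \<alpha> p (f v)"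
    if p: "p \<in> carrier (free_alg (sum_list \<alpha>))" and v: "v \<in> tab_span E" for p v
  proof -
    have "f (hecke_class (sum_list \<alpha>) p \<odot>\<^bsub>S_module \<alpha> E\<^esub> v) =
        hecke_class (sum_list \<alpha>) p \<odot>\<^bsub>S_module \<alpha> E\<^esub> f v"
      using f hecke_class_closed[OF p] v by (auto simp: module_End_def)
    then show ?thesis
      using smult_hecke_class[OF p SCT] v f_closed[OF v] by simp
  qed
  \<comment> \<open>\<open>module_End\<close> asks for additivity and compatibility with the
    algebra; complex homogeneity follows because the scalars are elements of the algebra.\<close>
  have f_scale: "f (cscale c v) = cscale c (f v)" if "v \<in> tab_span E" for c v
    using f_act[OF free_alg_scalar_closed[of c] that] by (simp add: free_act_scalar)
  have f_zero: "f 0 = 0"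
    using f_scale[OF tab_span_zero, of 0] by simp
  have f_pi: "f (pi_op \<alpha> i v) = pi_op \<alpha> i (f v)" if "i \<in> {1..<sum_list \<alpha>}" "v \<in> tab_span E" for i v
    using f_act[OF free_alg_gen_closed[OF that(1)] that(2)] by (simp add: free_act_gen)
  have f_fold: "f (foldr (pi_op \<alpha>) ws v) = foldr (pi_op \<alpha>) ws (f v)"
    if "set ws \<subseteq> {1..<sum_list \<alpha>}" "v \<in> tab_span E" for ws v
    using that
  proof (induction ws)
    case (Cons i ws)
    then show ?case
      using f_pi[OF _ foldr_pi_op_in_span[OF swap_closed_class[OF E]], of i v ws] by simp
  qed simp
  have f_sum: "f (\<Sum>x\<in>A. h x) = (\<Sum>x\<in>A. f (h x))" if "\<And>x. x \<in> A \<Longrightarrow> h x \<in> tab_span E"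
    for A :: "tableau set" and h
    using that
  proof (induction A rule: infinite_finite_induct)
    case (insert x A)
    then show ?case
      using f_add[of "h x" "sum h A"] tab_span_sum[of A h E] by simp
  qed (simp_all add: f_zero)
  obtain T0 where T0: "T0 \<in> E" "source \<alpha> T0"
    using class_source[OF E] .
  have basis: "basis T \<in> tab_span E" if "T \<in> E" for T
    using that by (simp add: tab_span_def)
  define c where "c = Poly_Mapping.lookup (f (basis T0)) T0"
  have "f (basis T0) = cscale c (basis T0)"
    unfolding c_def
  proof (rule source_image_multiple[OF E T0(2,1) f_closed[OF basis[OF T0(1)]]])
    fix i assume i: "i \<in> {1..<sum_list \<alpha>}" "i \<notin> Des \<alpha> T0"
    then have "pi_op \<alpha> i (basis T0) = basis T0"
      by (intro pi_op_fixing) (auto simp: fixing_def Des_iff)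
    then show "pi_op \<alpha> i (f (basis T0)) = f (basis T0)"
      using f_pi[OF i(1) basis[OF T0(1)]] by simp
  next
    fix ws assume "set ws \<subseteq> {1..<sum_list \<alpha>}" "foldr (pi_op \<alpha>) ws (basis T0) = 0"
    then show "foldr (pi_op \<alpha>) ws (f (basis T0)) = 0"
      using f_fold[OF _ basis[OF T0(1)], of ws] f_zero by simp
  qed
  have f_basis: "f (basis T) = cscale c (basis T)" if T: "T \<in> E" for T
  proof -
    obtain ws where ws: "set ws \<subseteq> {1..<sum_list \<alpha>}" "foldr (pi_op \<alpha>) ws (basis T0) = basis T"
      using source_generates[OF T0(2) class_equiv[OF E T0(1) T]] .
    then show ?thesis
      using f_fold[OF ws(1) basis[OF T0(1)]] \<open>f (basis T0) = cscale c (basis T0)\<close>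
      by (simp add: clin_scale[OF clin_foldr_pi_op])
  qed
  have "f v = cscale c v" if v: "v \<in> tab_span E" for v
  proof -
    have vE: "T \<in> E" if "T \<in> Poly_Mapping.keys v" for T
      using v that by (auto simp: tab_span_def)
    have sum: "v = (\<Sum>T\<in>Poly_Mapping.keys v. cscale (Poly_Mapping.lookup v T) (basis T))"
      using lin_ext_basis[of v] by (simp add: lin_ext_def)
    have "f v = (\<Sum>T\<in>Poly_Mapping.keys v. f (cscale (Poly_Mapping.lookup v T) (basis T)))"
      by (subst sum, rule f_sum) (intro tab_span_cscale basis vE)
    also have "\<dots> = lin_ext (\<lambda>T. cscale c (basis T)) v"
      unfolding lin_ext_def by (intro sum.cong) (simp_all add: f_scale basis vE f_basis)
    also have "\<dots> = cscale c v"
      by (rule clin_conv_lin_ext[symmetric]) (simp add: clin_def cscale_add_right mult.commute)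
    finally show ?thesis .
  qed
  then have "f = (\<lambda>v\<in>carrier (S_module \<alpha> E). cscale c v)"
    using f by (auto simp: module_End_def fun_eq_iff PiE_def extensional_def)
  then show thesis
    by (rule that)
qed

section \<open>Submodules and indecomposability\<close>

lemma submodule_span_closed:
  assumes E: "E \<in> sct_classes \<alpha>" and U: "submodule U (hecke0 (sum_list \<alpha>)) (S_module \<alpha> E)"
  shows "U \<subseteq> tab_span E" "0 \<in> U" "u \<in> U \<Longrightarrow> v \<in> U \<Longrightarrow> u + v \<in> U" "u \<in> U \<Longrightarrow> v \<in> U \<Longrightarrow> u - v \<in> U"
    "X \<in> carrier (hecke0 (sum_list \<alpha>)) \<Longrightarrow> u \<in> U \<Longrightarrow> X \<odot>\<^bsub>S_module \<alpha> E\<^esub> u \<in> U"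
proof -
  interpret U: submodule U "hecke0 (sum_list \<alpha>)" "S_module \<alpha> E"
    by (rule U)
  show sub: "U \<subseteq> tab_span E" and "0 \<in> U"
    and add: "\<And>u v. u \<in> U \<Longrightarrow> v \<in> U \<Longrightarrow> u + v \<in> U"
    and smult: "\<And>X u. X \<in> carrier (hecke0 (sum_list \<alpha>)) \<Longrightarrow> u \<in> U \<Longrightarrow> X \<odot>\<^bsub>S_module \<alpha> E\<^esub> u \<in> U"
    using U.subset U.one_closed U.m_closed U.smult_closed by simp_all
  show "u - v \<in> U" if "u \<in> U" "v \<in> U" for u v
  proof -
    have v: "v \<in> tab_span (SCT \<alpha>)"
      using that sub tab_span_mono[OF class_in_SCT[OF E]] by blast
    \<comment> \<open>Negatives are reached by letting the scalar -1 act, which yields the minus of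
      formal combinations directly.\<close>
    have "hecke_class (sum_list \<alpha>) (Poly_Mapping.single 0 (- 1)) \<odot>\<^bsub>S_module \<alpha> E\<^esub> v = - v"
      unfolding smult_hecke_class[OF free_alg_scalar_closed v] free_act_scalar by simp
    then have "- v \<in> U"
      using smult[OF hecke_class_closed[OF free_alg_scalar_closed] that(2), of "- 1"] by simp
    then show ?thesis
      using add[OF that(1)] by (metis add_uminus_conv_diff)
  qed
qed

text \<open>The projection onto a direct summand is an endomorphism.\<close>

lemma indecomposable_S_module:
  assumes E: "E \<in> sct_classes \<alpha>"
  shows "indecomposable_module (hecke0 (sum_list \<alpha>)) (S_module \<alpha> E)"
proof -
  let ?H = "hecke0 (sum_list \<alpha>)" and ?M = "S_module \<alpha> E"
  interpret M: left_module ?H ?M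
    by (rule left_module_S_module[OF E])
  obtain T where "T \<in> E"
    using class_source[OF E] by blast
  then have "basis T \<in> tab_span E" "basis T \<noteq> 0"
    by (auto simp: tab_span_def poly_mapping_eq_iff fun_eq_iff lookup_single)
  then have nonzero: "carrier ?M \<noteq> {\<zero>\<^bsub>?M\<^esub>}"
    by auto
  have "U = {0} \<or> W = {0}"
    if U: "submodule U ?H ?M" and W: "submodule W ?H ?M" and UW: "U \<inter> W = {0}"
      and span: "U <+>\<^bsub>?M\<^esub> W = tab_span E" for U W
  proof -
    note U = submodule_span_closed[OF E U] and W = submodule_span_closed[OF E W]
    \<comment> \<open>The projection onto \<open>U\<close> along \<open>W\<close>. The choice is
      unique because two candidates differ by an element of \<open>U \<inter> W\<close>.\<close>
    define P where "P = (\<lambda>v\<in>carrier ?M. THE u. u \<in> U \<and> v - u \<in> W)"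
    have P: "P v = u" if "v \<in> tab_span E" "u \<in> U" "v - u \<in> W" for u v
    proof -
      have "u' = u" if u': "u' \<in> U" "v - u' \<in> W" for u'
      proof -
        have "u' - u \<in> U \<inter> W"
          using U(4)[OF u'(1) \<open>u \<in> U\<close>] W(4)[OF \<open>v - u \<in> W\<close> u'(2)] by simp
        then show ?thesis
          using UW by simp
      qed
      then have "(THE u. u \<in> U \<and> v - u \<in> W) = u"
        using that by blast
      then show ?thesis
        using that by (simp add: P_def)
    qed
    have PU: "P v \<in> U \<and> v - P v \<in> W" if v: "v \<in> tab_span E" for v
    proof -
      have "v \<in> (\<Union>u\<in>U. \<Union>w\<in>W. {u + w})"
        using v span unfolding set_add_def' by simp
      then obtain u w where "u \<in> U" "w \<in> W" "v = u + w"
        by blast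
      then show ?thesis
        using P[OF v, of u] by simp
    qed
    have "P \<in> module_End ?H ?M"
      unfolding module_End_def
    proof (intro CollectI conjI ballI)
      show "P \<in> carrier ?M \<rightarrow>\<^sub>E carrier ?M"
        using PU U(1) by (auto simp: P_def)
    next
      fix x y assume "x \<in> carrier ?M" "y \<in> carrier ?M"
      then have xy: "x \<in> tab_span E" "y \<in> tab_span E" by simp_all
      have "(x - P x) + (y - P y) \<in> W"
        using PU[OF xy(1)] PU[OF xy(2)] W(3) by blast
      then have "P (x + y) = P x + P y"
        using PU[OF xy(1)] PU[OF xy(2)] U(3) xy
        by (intro P) (auto simp: tab_span_add algebra_simps)
      then show "P (x \<oplus>\<^bsub>?M\<^esub> y) = P x \<oplus>\<^bsub>?M\<^esub> P y"
        by simp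
    next
      fix X x assume X: "X \<in> carrier ?H" and "x \<in> carrier ?M"
      then have x: "x \<in> tab_span E" by simp
      have Px: "P x \<in> U" "x - P x \<in> W"
        using PU[OF x] by auto
      have "X \<odot>\<^bsub>?M\<^esub> (P x \<oplus>\<^bsub>?M\<^esub> (x - P x)) = X \<odot>\<^bsub>?M\<^esub> P x \<oplus>\<^bsub>?M\<^esub> X \<odot>\<^bsub>?M\<^esub> (x - P x)"
        using Px U(1) W(1) X by (intro M.smult_r_distr) auto
      then have "X \<odot>\<^bsub>?M\<^esub> x - X \<odot>\<^bsub>?M\<^esub> P x = X \<odot>\<^bsub>?M\<^esub> (x - P x)"
        by simp
      then have "X \<odot>\<^bsub>?M\<^esub> x - X \<odot>\<^bsub>?M\<^esub> P x \<in> W"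
        using W(5)[OF X Px(2)] by simp
      then show "P (X \<odot>\<^bsub>?M\<^esub> x) = X \<odot>\<^bsub>?M\<^esub> P x"
        using M.smult_closed[OF X, of x] x U(5)[OF X Px(1)] by (intro P) auto
    qed
    then obtain c where c: "P = (\<lambda>v\<in>carrier ?M. cscale c v)"
      using module_End_scalar[OF E] by blast
    show ?thesis
    proof (rule disjCI)
      assume "W \<noteq> {0}"
      then obtain w where w: "w \<in> W" "w \<noteq> 0"
        using W(2) by blast
      \<comment> \<open>The projection is multiplication by \<open>c\<close>. It kills the nonzero
        \<open>w\<close>, so \<open>c = 0\<close>; since it fixes \<open>U\<close> pointwise,
        \<open>U\<close> is zero.\<close>
      have "cscale c w = 0"
        using P[of w 0] w W(1) U(2) by (auto simp: c)
      then have "c = 0"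
        using w(2) by (auto simp: poly_mapping_eq_iff fun_eq_iff)
      have "u = 0" if "u \<in> U" for u
        using P[of u u] that U(1) W(2) by (auto simp: c \<open>c = 0\<close>)
      then show "U = {0}"
        using U(2) by blast
    qed
  qed
  then show ?thesis
    using M.left_module_axioms nonzero unfolding indecomposable_module_def by simp
qed

theorem theorem4p11:
  fixes n :: nat and \<alpha> :: "nat list" and E :: "tableau set"
  assumes "n \<ge> 1"
    and "\<alpha> \<in> compositions n"
    and "E \<in> sct_classes \<alpha>"
  shows "module_End (hecke0 n) (S_module \<alpha> E) =
           {\<lambda>v\<in>carrier (S_module \<alpha> E). cscale c v | c. c \<in> UNIV} \<and>
         indecomposable_module (hecke0 n) (S_module \<alpha> E)"
proof -
  have n: "n = sum_list \<alpha>"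
    using assms(2) by (simp add: compositions_def)
  have "f \<in> {\<lambda>v\<in>carrier (S_module \<alpha> E). cscale c v | c. c \<in> UNIV}"
    if "f \<in> module_End (hecke0 n) (S_module \<alpha> E)" for f
    using module_End_scalar[OF assms(3) that[unfolded n]] by blast
  moreover have "f \<in> module_End (hecke0 n) (S_module \<alpha> E)"
    if "f \<in> {\<lambda>v\<in>carrier (S_module \<alpha> E). cscale c v | c. c \<in> UNIV}" for f
    using that scalar_in_module_End[OF assms(3)] unfolding n by blast
  ultimately show ?thesis
    using indecomposable_S_module[OF assms(3)] unfolding n by blast
qed

end
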